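(* Let $p$ be an odd prime and let $x\in\mathbb{C}_p^{\times}$ with $|x|_p>1$. For $n\ge 1$ and $j\ge 0$ let $\sigma_{j-1}^{*}(n)=\sum_{d\mid n,\ p\nmid d} d^{\,j-1}$. Define $$a_0(s,x)=\tfrac12\zeta_p(1-s,x),\qquad a_n(s,x)=\int_{\mathbb{Z}_p}\omega_v(x+a)\langle x+a\rangle^{s}\,d\mu_n(a)\quad(n\ge1),$$ the formal $q$-series $G^{*}(s,x)=a_0(s,x)+\sum_{n=1}^{\infty}a_n(s,x)q^n$, and $$e_{p,j}(s)=-\frac{B_j}{2s}+\sum_{n=1}^{\infty}\sigma_{j-1}^{*}(n)q^n .$$ Then there is an identity of analytic functions (coefficientwise in $q$) $$G^{*}(s,x)=x\langle x\rangle^{s-1}\sum_{j=0}^{\infty}\binom{s}{j}e_{p,j}(s)\,x^{-j}$$ on the disc $|s-1|_p<p^{-1/(p-1)}|\log_p\langle x\rangle|_p^{-1}$. If in addition $x$ lies in a finite extension $K$ of $\mathbb{Q}_p$ whose ramification index over $\mathbb{Q}_p$ is less than $p-1$, then the formula is valid for all $s\in\mathbb{C}_p\setminus\{0\}$ with $|s-1|_p<|\pi|_p^{-1}p^{-1/(p-1)}$, where $(\pi)$ is the maximal ideal of the ring of integers $O_K$ of $K$.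
   Context: $\mathbb{C}_p$ is the completion of an algebraic closure of $\mathbb{Q}_p$, $|p|_p=p^{-1}$, $v_p$ the valuation. Fix an embedding $\overline{\mathbb{Q}}\hookrightarrow\mathbb{C}_p$; let $p^{\mathbb{Q}}$ be the image of positive real rational powers of $p$. For $x\in\mathbb{C}_p^\times$ write $x=p^{v_p(x)}u$ with $p^{v_p(x)}\in p^{\mathbb{Q}}$, $|u|_p=1$, and let $\hat x$ be the unique root of unity of order prime to $p$ with $|u-\hat x|_p<1$. Set $\langle x\rangle=p^{-v_p(x)}x/\hat x$ and $\omega_v(x)=x/\langle x\rangle$. For $s\in\mathbb{C}_p$, $\langle x\rangle^{s}=\sum_{n\ge0}\binom{s}{n}(\langle x\rangle-1)^n$; $\log_p$ is the $p$-adic logarithm. The Volkenborn integral is $\int_{\mathbb{Z}_p}f(a)\,da=\lim_{N\to\infty}p^{-N}\sum_{a=0}^{p^N-1}f(a)$. For $x\in\mathbb{C}_p\setminus\mathbb{Z}_p$ the $p$-adic Hurwitz zeta function is $\zeta_p(s,x)=\frac{1}{s-1}\int_{\mathbb{Z}_p}\omega_v(x+a)\langle x+a\rangle^{1-s}\,da$. For $d\in\mathbb{Z}_p$, $\delta_d$ is the Dirac measure at $d$ (value $1$ on open sets containing $d$, $0$ otherwise), and for $n\ge1$, $\mu_n=\sum_{d\mid n,\ p\nmid d}d^{-1}\delta_d$. $B_j$ are the Bernoulli numbers, $t/(e^t-1)=\sum_j B_jt^j/j!$.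
   Formalization: The first identity is claimed only at those s in the disc where the series for ⟨x+a⟩^s converges for all a in Z_p, with analyticity on discs about 1 inside that set; on the full disc it fails, e.g. x=p^{-1/2}(1+p^3), s=1/p, where a_1(s,x) diverges. *)

theory Defs
  imports
    "HOL-Analysis.Analysis"
    "HOL-Computational_Algebra.Computational_Algebra"
begin

section \<open>The field of p-adic complex numbers\<close>

text \<open>
  The absolute value of the field is the distance to zero. The class of normed fields of the
  library is not usable here, because it presupposes a compatible real vector space structure.
\<close>

definition pnorm :: "'a::{zero, metric_space} \<Rightarrow> real"
  where "pnorm z = dist z 0"

text \<open>The copies of the p-adic integers and the p-adic numbers: closures of the integers and
  of the rationals.\<close>

definition padic_ints :: "'a::{field_char_0, metric_space} set"
  where "padic_ints = closure \<int>"

definition padic_nums :: "'a::{field_char_0, metric_space} set"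
  where "padic_nums = closure \<rat>"

definition padic_algebraic :: "'a::{field_char_0, metric_space} \<Rightarrow> bool"
  where "padic_algebraic z \<longleftrightarrow>
    (\<exists>f. f \<noteq> 0 \<and> (\<forall>i. coeff f i \<in> padic_nums) \<and> poly f z = 0)"

text \<open>
  A type is (a copy of) the completion of an algebraic closure of the p-adic numbers if it is an
  algebraically closed field, complete for a multiplicative ultrametric absolute value that takes
  the value 1/p at p, in which the elements algebraic over the closure of the rationals are dense.
  This determines the valued field up to isometric isomorphism. Algebraic closedness and
  completeness are part of the sort.
\<close>

locale padic_complex =
  fixes p :: nat
    and ty :: "'a::{field_char_0, alg_closed_field, complete_space} itself"
  assumes prime_p: "prime p"
    and dist_eq_pnorm: "\<And>y z :: 'a. dist y z = pnorm (y - z)"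
    and pnorm_mult: "\<And>y z :: 'a. pnorm (y * z) = pnorm y * pnorm z"
    and pnorm_ultrametric: "\<And>y z :: 'a. pnorm (y + z) \<le> max (pnorm y) (pnorm z)"
    and pnorm_p: "pnorm (of_nat p :: 'a) = 1 / real p"
    and algebraic_dense: "closure {z :: 'a. padic_algebraic z} = UNIV"

text \<open>The algebraic numbers are those inside the complex numbers; values of the embedding at
  transcendental numbers are irrelevant.\<close>

locale Qbar_embedding =
  fixes \<iota> :: "complex \<Rightarrow> 'a::field"
  assumes one: "\<iota> 1 = 1"
    and add: "\<And>y z. algebraic y \<Longrightarrow> algebraic z \<Longrightarrow> \<iota> (y + z) = \<iota> y + \<iota> z"
    and mult: "\<And>y z. algebraic y \<Longrightarrow> algebraic z \<Longrightarrow> \<iota> (y * z) = \<iota> y * \<iota> z"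


section \<open>Teichmueller decomposition, powers and logarithm\<close>

definition vp :: "nat \<Rightarrow> 'a::{zero, metric_space} \<Rightarrow> real"
  where "vp p x = - log (real p) (pnorm x)"

text \<open>The image of the positive real number \<open>p\<^sup>r\<close>; meant for rational \<open>r\<close> only, and valuations
  of nonzero elements are rational.\<close>

definition ppow :: "nat \<Rightarrow> (complex \<Rightarrow> 'a) \<Rightarrow> real \<Rightarrow> 'a"
  where "ppow p \<iota> r = \<iota> (complex_of_real (real p powr r))"

definition teich :: "nat \<Rightarrow> (complex \<Rightarrow> 'a) \<Rightarrow> 'a::{field_char_0, metric_space} \<Rightarrow> 'a"
  where "teich p \<iota> x =
    (THE z. (\<exists>m>0. coprime m p \<and> z ^ m = 1) \<and> pnorm (x / ppow p \<iota> (vp p x) - z) < 1)"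

definition unit_part :: "nat \<Rightarrow> (complex \<Rightarrow> 'a) \<Rightarrow> 'a::{field_char_0, metric_space} \<Rightarrow> 'a"
  where "unit_part p \<iota> x = x / ppow p \<iota> (vp p x) / teich p \<iota> x"

definition omega_v :: "nat \<Rightarrow> (complex \<Rightarrow> 'a) \<Rightarrow> 'a::{field_char_0, metric_space} \<Rightarrow> 'a"
  where "omega_v p \<iota> x = x / unit_part p \<iota> x"

definition padic_pow :: "'a::{field_char_0, metric_space} \<Rightarrow> 'a \<Rightarrow> 'a"
  where "padic_pow y s = (\<Sum>n. (s gchoose n) * (y - 1) ^ n)"

text \<open>The logarithm is only needed on the open unit disc about 1, where it is given by its
  power series.\<close>

definition plog :: "'a::{field_char_0, metric_space} \<Rightarrow> 'a"
  where "plog y = (\<Sum>n. (- 1) ^ n * (y - 1) ^ Suc n / of_nat (Suc n))"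


section \<open>Integrals and the zeta function\<close>

definition volkenborn :: "nat \<Rightarrow> ('a \<Rightarrow> 'a::{field_char_0, metric_space}) \<Rightarrow> 'a"
  where "volkenborn p f = lim (\<lambda>N. (\<Sum>a<p ^ N. f (of_nat a)) / of_nat p ^ N)"

definition hurwitz_zeta_p ::
    "nat \<Rightarrow> (complex \<Rightarrow> 'a) \<Rightarrow> 'a \<Rightarrow> 'a::{field_char_0, metric_space} \<Rightarrow> 'a"
  where "hurwitz_zeta_p p \<iota> s x =
    1 / (s - 1) *
      volkenborn p (\<lambda>a. omega_v p \<iota> (x + a) * padic_pow (unit_part p \<iota> (x + a)) (1 - s))"

definition dirac :: "'a \<Rightarrow> 'a set \<Rightarrow> 'b::zero_neq_one"
  where "dirac d U = (if d \<in> U then 1 else 0)"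

definition mu :: "nat \<Rightarrow> nat \<Rightarrow> 'a::{field_char_0, metric_space} set \<Rightarrow> 'a"
  where "mu p n U = (\<Sum>d | d dvd n \<and> \<not> p dvd d. inverse (of_nat d) * dirac (of_nat d) U)"

text \<open>Integration over the p-adic integers against a measure, as limit of Riemann sums over the
  cosets of the powers of p.\<close>

definition padic_coset :: "nat \<Rightarrow> nat \<Rightarrow> nat \<Rightarrow> 'a::{field_char_0, metric_space} set"
  where "padic_coset p N a = (\<lambda>z. of_nat a + of_nat p ^ N * z) ` padic_ints"

definition padic_integral ::
    "nat \<Rightarrow> ('a set \<Rightarrow> 'a) \<Rightarrow> ('a \<Rightarrow> 'a::{field_char_0, metric_space}) \<Rightarrow> 'a"
  where "padic_integral p \<nu> f = lim (\<lambda>N. \<Sum>a<p ^ N. f (of_nat a) * \<nu> (padic_coset p N a))"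


section \<open>The two families of q-series\<close>

definition G_coeff ::
    "nat \<Rightarrow> (complex \<Rightarrow> 'a) \<Rightarrow> 'a \<Rightarrow> 'a \<Rightarrow> nat \<Rightarrow> 'a::{field_char_0, metric_space}"
  where "G_coeff p \<iota> s x n =
    (if n = 0 then 1 / 2 * hurwitz_zeta_p p \<iota> (1 - s) x
     else padic_integral p (mu p n)
            (\<lambda>a. omega_v p \<iota> (x + a) * padic_pow (unit_part p \<iota> (x + a)) s))"

definition G_star ::
    "nat \<Rightarrow> (complex \<Rightarrow> 'a) \<Rightarrow> 'a \<Rightarrow> 'a \<Rightarrow> 'a::{field_char_0, metric_space} fps"
  where "G_star p \<iota> s x = Abs_fps (G_coeff p \<iota> s x)"

definition bernoulli :: "nat \<Rightarrow> 'a::field_char_0"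
  where "bernoulli j = fact j * fps_nth (fps_X / (fps_exp 1 - 1)) j"

text \<open>\<open>sigma_star p j n\<close> is the sum with exponent \<open>j - 1\<close>, which is \<open>-1\<close> for \<open>j = 0\<close>.\<close>

definition sigma_star :: "nat \<Rightarrow> nat \<Rightarrow> nat \<Rightarrow> 'a::field_char_0"
  where "sigma_star p j n = (\<Sum>d | d dvd n \<and> \<not> p dvd d. of_nat d powi (int j - 1))"

definition e_series :: "nat \<Rightarrow> nat \<Rightarrow> 'a \<Rightarrow> 'a::field_char_0 fps"
  where "e_series p j s =
    Abs_fps (\<lambda>n. if n = 0 then - bernoulli j / (2 * s) else sigma_star p j n)"

text \<open>Coefficientwise convergence for the topology of the coefficient field. The topology that the
  library puts on formal power series is a different one (the coefficients are discrete).\<close>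

definition coeffwise_sums ::
    "(nat \<Rightarrow> 'a::{comm_monoid_add, topological_space} fps) \<Rightarrow> 'a fps \<Rightarrow> bool"
  where "coeffwise_sums F S \<longleftrightarrow> (\<forall>n. (\<lambda>j. fps_nth (F j) n) sums fps_nth S n)"

definition G_star_expansion ::
    "nat \<Rightarrow> (complex \<Rightarrow> 'a) \<Rightarrow> 'a::{field_char_0, metric_space} \<Rightarrow> 'a \<Rightarrow> bool"
  where "G_star_expansion p \<iota> s x \<longleftrightarrow>
    (\<exists>S. coeffwise_sums
           (\<lambda>j. fps_const (s gchoose j) * e_series p j s * fps_const (x powi (- int j))) S \<and>
         G_star p \<iota> s x = fps_const (x * padic_pow (unit_part p \<iota> x) (s - 1)) * S)"


section \<open>Domains and analyticity\<close>

text \<open>The set of exponents \<open>s\<close> at which the binomial series defining the integrand of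
  \<open>G_star p \<iota> s x\<close> converges on all of the p-adic integers. A bound
  on \<open>s - 1\<close> in terms of the logarithm of \<open>unit_part p \<iota> x\<close> alone does not imply convergence:
  for \<open>x = p\<^sup>-\<^sup>1\<^sup>/\<^sup>2\<close> the unit part of \<open>x\<close> is 1 and that of \<open>x + 1\<close> is \<open>1 + p\<^sup>1\<^sup>/\<^sup>2\<close>, whose
  binomial series diverges at \<open>s = 1/p\<close>.\<close>

definition G_domain ::
    "nat \<Rightarrow> (complex \<Rightarrow> 'a) \<Rightarrow> 'a::{field_char_0, metric_space} \<Rightarrow> 'a set"
  where "G_domain p \<iota> x =
    {s. \<forall>a\<in>padic_ints. summable (\<lambda>n. (s gchoose n) * (unit_part p \<iota> (x + a) - 1) ^ n)}"

definition power_series_on ::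
    "'a set \<Rightarrow> 'a \<Rightarrow> ('a \<Rightarrow> 'a::{field_char_0, metric_space}) \<Rightarrow> bool"
  where "power_series_on D c f \<longleftrightarrow> (\<exists>b. \<forall>s\<in>D. (\<lambda>k. b k * (s - c) ^ k) sums f s)"

text \<open>The coefficients are analytic on the disc about 1, except for an at most simple pole of the
  constant coefficient at \<open>s = 0\<close>, if the disc contains 0.\<close>

definition G_star_analytic ::
    "nat \<Rightarrow> (complex \<Rightarrow> 'a) \<Rightarrow> 'a::{field_char_0, metric_space} \<Rightarrow> real \<Rightarrow> bool"
  where "G_star_analytic p \<iota> x r \<longleftrightarrow>
    (\<forall>n\<ge>1. power_series_on (ball 1 r) 1 (\<lambda>s. fps_nth (G_star p \<iota> s x) n)) \<and>
    power_series_on (ball 1 r - {0}) 1 (\<lambda>s. s * fps_nth (G_star p \<iota> s x) 0)"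


section \<open>Finite extensions of the p-adic numbers\<close>

definition finite_ext :: "'a::{field_char_0, metric_space} set \<Rightarrow> bool"
  where "finite_ext K \<longleftrightarrow>
    padic_nums \<subseteq> K \<and>
    (\<forall>y\<in>K. \<forall>z\<in>K. y - z \<in> K \<and> y * z \<in> K) \<and> (\<forall>y\<in>K. inverse y \<in> K) \<and>
    (\<exists>B. finite B \<and> B \<subseteq> K \<and>
      K = {\<Sum>b\<in>B. c b * b | c. \<forall>b\<in>B. c b \<in> padic_nums})"

definition int_ring :: "'a::{zero, metric_space} set \<Rightarrow> 'a set"
  where "int_ring K = {z \<in> K. pnorm z \<le> 1}"

definition max_ideal :: "'a::{zero, metric_space} set \<Rightarrow> 'a set"
  where "max_ideal K = {z \<in> K. pnorm z < 1}"

definition gen_ideal :: "'a set \<Rightarrow> 'a \<Rightarrow> 'a::{field_char_0, metric_space} set"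
  where "gen_ideal K y = (\<lambda>z. y * z) ` int_ring K"

definition ram_index :: "nat \<Rightarrow> 'a::{field_char_0, metric_space} set \<Rightarrow> nat"
  where "ram_index p K =
    (THE e. \<exists>\<pi>\<in>K. max_ideal K = gen_ideal K \<pi> \<and> gen_ideal K (of_nat p) = gen_ideal K (\<pi> ^ e))"

end

theory Submission
  imports Defs
begin

text \<open>
  Put \<open>u = \<langle>x\<rangle>\<close> and \<open>\<rho> = max |u - 1| |1/x| < 1\<close>. For \<open>|a| \<le> 1\<close> one has \<open>\<langle>x + a\<rangle> = u (1 + a/x)\<close> and
  \<open>\<omega>(x + a) = \<omega>(x)\<close>, and \<open>|\<langle>x + a\<rangle> - 1|\<close> is at most \<open>\<rho>\<close>, with equality for \<open>a = 0\<close> or \<open>a = 1\<close>. Hence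
  the binomial series converge at \<open>s\<close> on all p-adic integers iff \<open>|s gchoose n| \<rho>\<^sup>n\<close> tends to 0. For such
  \<open>s\<close> the binomial series is multiplicative, so that \<open>\<omega>(x + a) \<langle>x + a\<rangle>\<^sup>s = \<omega>(x) u\<^sup>s (1 + a/x)\<^sup>s\<close>; expanding
  the last factor in powers of \<open>a/x\<close> and integrating term by term gives the expansion.

  For the analyticity, a ball about 1 in the domain of convergence contains elements whose distance
  to 1 is no integral power of p. At these, the norm of \<open>s gchoose n\<close> equals the Gauss norm of the
  binomial polynomial, so that the binomial series may be rearranged into a power series in \<open>s - 1\<close>.

  In the ramified case \<open>\<rho> \<le> |\<pi>|\<close>, and \<open>|n!| \<ge> p powr (- n / (p - 1))\<close> gives convergence.
\<close>

section \<open>Binomial polynomials and Bernoulli numbers\<close>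

text \<open>In an ultrametric field a series converges as soon as its terms tend to 0, so every
  interchange of limits reduces to one null sequence that bounds the terms uniformly. Here that
  sequence is always a multiple of \<open>pnorm (s gchoose n) * \<rho> ^ n\<close>. Term by term
  Volkenborn integration costs no convergence, because the finite means of all monomials have norm
  at most p, uniformly in the exponent and in the stage; their limits are the Bernoulli numbers.

  The factors of x are given by a definite description and by a partly specified embedding, so their
  properties have to be extracted from the axioms. This is where the density of the algebraic
  elements enters: every nonzero element shares its norm, and every unit its residue, with an
  algebraic one. Hence norms are rational powers of p, and residues of units have finite order,
  which can be made prime to p by means of the Frobenius map.\<close>

lemma LIMSEQ_zero_dominated:
  fixes f g :: "nat \<Rightarrow> real"
  assumes "\<And>n. 0 \<le> f n" "\<And>n. f n \<le> g n" "g \<longlonglongrightarrow> 0"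
  shows "f \<longlonglongrightarrow> 0"
  by (rule tendsto_sandwich[OF _ _ tendsto_const assms(3)]) (auto simp: assms)

text \<open>The condition depends on a real radius and not on a point, so that one statement covers
  the binomial series at all z with norm at most \<rho>.\<close>

definition binom_null :: "'a::{field_char_0, metric_space} \<Rightarrow> real \<Rightarrow> bool"
  where "binom_null s \<rho> \<longleftrightarrow> (\<lambda>n. pnorm (s gchoose n) * \<rho> ^ n) \<longlonglongrightarrow> 0"

text \<open>The binomial polynomial in the variable \<open>h = s - 1\<close>, since the power series
  in s are centred at 1. The recursion adds one linear factor at a time, which is what the estimate
  of the coefficients follows.\<close>

primrec shifted_binom_poly :: "nat \<Rightarrow> 'a::field_char_0 poly" where
  "shifted_binom_poly 0 = 1"
| "shifted_binom_poly (Suc n) =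
     smult (1 / of_nat (Suc n)) ([:1 - of_nat n, 1:] * shifted_binom_poly n)"

lemma gbinomial_Suc_mult:
  "(s :: 'a::field_char_0) gchoose Suc n = (s gchoose n) * (s - of_nat n) / of_nat (Suc n)"
proof -
  have "fact (Suc n) * (s gchoose Suc n) = fact n * (s gchoose n) * (s - of_nat n)"
    by (simp only: gbinomial_mult_fact prod.atLeast0_lessThan_Suc)
  then have "fact n * (of_nat (Suc n) * (s gchoose Suc n)) = fact n * ((s gchoose n) * (s - of_nat n))"
    by (simp only: fact_Suc of_nat_mult mult_ac of_nat_fact)
  then have "of_nat (Suc n) * (s gchoose Suc n) = (s gchoose n) * (s - of_nat n)"
    by (subst (asm) mult_cancel_left) simp
  then show ?thesis
    by (subst nonzero_eq_divide_eq) (auto simp: mult.commute simp del: of_nat_Suc)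
qed

lemma poly_shifted_binom_poly: "poly (shifted_binom_poly n) h = (1 + h) gchoose n"
  by (induction n)
    (simp_all add: gbinomial_Suc_mult algebra_simps add_divide_distrib diff_divide_distrib
      del: of_nat_Suc)

lemma degree_shifted_binom_poly: "degree (shifted_binom_poly n) \<le> n"
proof (induction n)
  case (Suc n)
  have "degree ([:1 - of_nat n, 1:] * shifted_binom_poly n :: 'a poly)
    \<le> degree [:1 - of_nat n, 1 :: 'a:] + degree (shifted_binom_poly n :: 'a poly)"
    by (rule degree_mult_le)
  then show ?case
    using Suc by (simp del: mult_pCons_left)
qed simp

lemma max_mult_le:
  assumes "a * c \<le> d" "b * c \<le> (d :: real)"
  shows "max a b * c \<le> d"
  using assms by (cases "a \<le> b") (auto simp: max_def)

definition vmean :: "nat \<Rightarrow> nat \<Rightarrow> ('a \<Rightarrow> 'a::{field_char_0, metric_space}) \<Rightarrow> 'a"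
  where "vmean p N f = (\<Sum>a<p ^ N. f (of_nat a)) / of_nat p ^ N"

text \<open>The Volkenborn integral of \<open>(\<alpha> + \<beta> * a) ^ n\<close>; for nonzero
  \<beta> it is \<open>\<beta> ^ n\<close> times the n-th Bernoulli polynomial at
  \<open>\<alpha> / \<beta>\<close>.\<close>

definition affine_moment :: "'a::field_char_0 \<Rightarrow> 'a \<Rightarrow> nat \<Rightarrow> 'a"
  where "affine_moment \<alpha> \<beta> n = (\<Sum>i\<le>n. of_nat (n choose i) * \<beta> ^ i * \<alpha> ^ (n - i) * bernoulli i)"

text \<open>Compare the coefficients of t^(j+1) in t/(e^t - 1) * (e^(Mt) - 1) = t * (1 + e^t + ... +
  e^((M-1)t)).\<close>

lemma power_sum_bernoulli:
  "(\<Sum>a<M. of_nat a ^ j) =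
    (\<Sum>i\<le>j. fact j * (bernoulli i / fact i) * (of_nat M ^ (j + 1 - i) / fact (j + 1 - i)) :: 'a::field_char_0)"
proof -
  define E where "E = fps_exp (1 :: 'a)"
  define B where "B = fps_X / (E - 1)"
  have E1: "E - 1 \<noteq> 0"
    using arg_cong[of "E - 1" 0 "\<lambda>f. fps_nth f 1"] by (auto simp: E_def)
  \<comment> \<open>Division of formal power series is only known to cancel when the divisor
    divides, and divisibility is a comparison of subdegrees.\<close>
  have "subdegree (E - 1) = 1"
    by (rule subdegreeI) (auto simp: E_def)
  then have "E - 1 dvd fps_X"
    using E1 by (subst fps_dvd_iff) auto
  then have B: "B * (E - 1) = fps_X" unfolding B_def by (rule dvd_div_mult_self)
  have EM: "E ^ a = fps_exp (of_nat a)" for a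
    unfolding E_def by (simp add: fps_exp_power_mult)
  have "B * (E ^ M - 1) = fps_X * (\<Sum>a<M. E ^ a)"
    by (simp add: power_diff_1_eq B flip: mult.assoc)
  then have "fps_nth (B * (E ^ M - 1)) (Suc j) = fps_nth (fps_X * (\<Sum>a<M. E ^ a)) (Suc j)"
    by simp
  also have "\<dots> = (\<Sum>a<M. of_nat a ^ j) / fact j"
    by (simp add: EM fps_sum_nth sum_divide_distrib)
  also have "fps_nth (B * (E ^ M - 1)) (Suc j) =
      (\<Sum>i\<le>j. (bernoulli i / fact i) * (of_nat M ^ (j + 1 - i) / fact (j + 1 - i)))"
  proof -
    have Bi: "fps_nth B i = bernoulli i / fact i" for i
      by (simp add: bernoulli_def B_def E_def)
    have "fps_nth (B * (E ^ M - 1)) (Suc j) = (\<Sum>i\<le>Suc j. fps_nth B i * fps_nth (E ^ M - 1) (Suc j - i))"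
      by (simp add: fps_mult_nth atLeast0AtMost)
    \<comment> \<open>The summand \<open>i = Suc j\<close> vanishes because \<open>E ^ M - 1\<close>
      has constant coefficient 0.\<close>
    also have "\<dots> = (\<Sum>i\<le>j. fps_nth B i * fps_nth (E ^ M - 1) (Suc j - i))"
      by (simp add: EM)
    also have "\<dots> = (\<Sum>i\<le>j. (bernoulli i / fact i) * (of_nat M ^ (j + 1 - i) / fact (j + 1 - i)))"
      by (intro sum.cong) (simp_all add: Bi EM Suc_diff_le del: fact_Suc)
    finally show ?thesis .
  qed
  finally show ?thesis
    by (simp add: nonzero_eq_divide_eq sum_distrib_left mult_ac)
qed

section \<open>Ultrametric norm and series\<close>

context padic_complex
begin

lemma pnorm_nonneg [simp]: "0 \<le> pnorm (z :: 'a)"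
  by (simp add: pnorm_def)

lemma pnorm_zero [simp]: "pnorm (0 :: 'a) = 0"
  by (simp add: pnorm_def)

lemma pnorm_eq_0_iff [simp]: "pnorm (z :: 'a) = 0 \<longleftrightarrow> z = 0"
  by (simp add: pnorm_def)

lemma pnorm_pos_iff [simp]: "0 < pnorm (z :: 'a) \<longleftrightarrow> z \<noteq> 0"
  by (simp add: pnorm_def)

lemma nonzero_of_pnorm_gt_1: "1 < pnorm (z :: 'a) \<Longrightarrow> z \<noteq> 0"
  by auto

lemma pnorm_one [simp]: "pnorm (1 :: 'a) = 1"
  using pnorm_mult[of 1 1] pnorm_eq_0_iff[of 1] by (simp del: pnorm_eq_0_iff)

lemma pnorm_minus [simp]: "pnorm (- z :: 'a) = pnorm z"
  using dist_eq_pnorm[of 0 z] by (simp add: pnorm_def dist_commute)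

lemma pnorm_minus_commute: "pnorm (y - z :: 'a) = pnorm (z - y)"
  using pnorm_minus[of "z - y"] by simp

lemma pnorm_diff_le: "pnorm (y - z :: 'a) \<le> max (pnorm y) (pnorm z)"
  using pnorm_ultrametric[of y "- z"] by simp

lemma pnorm_power: "pnorm (z ^ n :: 'a) = pnorm z ^ n"
  by (induction n) (auto simp: pnorm_mult)

lemma pnorm_inverse: "pnorm (inverse z :: 'a) = inverse (pnorm z)"
proof (cases "z = 0")
  case False
  then have "pnorm z * pnorm (inverse z) = 1"
    by (simp flip: pnorm_mult)
  then show ?thesis
    by (simp add: inverse_unique)
qed simp

lemma pnorm_divide: "pnorm (y / z :: 'a) = pnorm y / pnorm z"
  by (simp add: divide_inverse pnorm_mult pnorm_inverse)

lemma pnorm_prod: "pnorm (\<Prod>i\<in>A. f i :: 'a) = (\<Prod>i\<in>A. pnorm (f i))"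
  by (induction A rule: infinite_finite_induct) (auto simp: pnorm_mult)

lemma pnorm_sum_le:
  fixes f :: "'b \<Rightarrow> 'a"
  assumes "\<And>i. i \<in> A \<Longrightarrow> pnorm (f i) \<le> B" "0 \<le> B"
  shows "pnorm (sum f A) \<le> B"
  using assms
  by (induction A rule: infinite_finite_induct) (auto intro!: order.trans[OF pnorm_ultrametric])

lemma pnorm_sum_less:
  fixes f :: "'b \<Rightarrow> 'a"
  assumes "\<And>i. i \<in> A \<Longrightarrow> pnorm (f i) < B" "0 < B"
  shows "pnorm (sum f A) < B"
  using assms
  by (induction A rule: infinite_finite_induct) (auto intro!: le_less_trans[OF pnorm_ultrametric])

lemma pnorm_add_eq:
  assumes "pnorm (y :: 'a) < pnorm z"
  shows "pnorm (y + z) = pnorm z" "pnorm (z + y) = pnorm z"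
proof -
  have "pnorm z \<le> max (pnorm (y + z)) (pnorm y)"
    using pnorm_diff_le[of "y + z" y] by simp
  then show "pnorm (y + z) = pnorm z"
    using pnorm_ultrametric[of y z] assms by linarith
  then show "pnorm (z + y) = pnorm z"
    by (simp add: add.commute)
qed

lemma pnorm_eq_of_diff_less:
  assumes "pnorm (y - z :: 'a) < pnorm z"
  shows "pnorm y = pnorm z"
  using pnorm_add_eq(1)[OF assms] by simp

lemma pnorm_diff_trans:
  assumes "pnorm (a - b :: 'a) < e" "pnorm (b - c) < e"
  shows "pnorm (a - c) < e"
  using pnorm_ultrametric[of "a - b" "b - c"] assms by simp

section \<open>Norms of integers, rationals and p-adic numbers\<close>

lemma pnorm_of_nat_le_1: "pnorm (of_nat n :: 'a) \<le> 1"
  by (induction n) (auto intro!: order.trans[OF pnorm_ultrametric])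

lemma pnorm_of_int_le_1: "pnorm (of_int n :: 'a) \<le> 1"
  by (cases n rule: int_cases2) (auto simp: pnorm_of_nat_le_1)

lemma p_gt_1: "p > 1"
  using prime_p by (rule prime_gt_1_nat)

lemma pnorm_p_powi: "pnorm (of_nat p powi i :: 'a) = real p powi (- i)"
  by (simp add: power_int_def pnorm_power pnorm_inverse pnorm_p power_inverse
      flip: inverse_eq_divide)

text \<open>If m had norm below 1, then so would both terms of a Bezout relation
  \<open>u * m + v * p = 1\<close>, and hence 1 itself.\<close>

lemma pnorm_of_int_coprime:
  assumes "\<not> int p dvd m"
  shows "pnorm (of_int m :: 'a) = 1"
proof -
  have "coprime m (int p)"
    using assms prime_imp_coprime[of "int p" m] prime_p by (simp add: coprime_commute)
  then obtain u v where "u * m + v * int p = 1"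
    using bezout_int[of m "int p"] by auto
  then have "(of_int (u * m + v * int p) :: 'a) = of_int 1"
    by (rule arg_cong)
  then have uv: "of_int u * of_int m + of_int v * of_nat p = (1 :: 'a)"
    by simp
  have "pnorm (of_int v * of_nat p :: 'a) < 1"
  proof -
    have "pnorm (of_int v * of_nat p :: 'a) \<le> 1 * (1 / real p)"
      unfolding pnorm_mult pnorm_p by (intro mult_right_mono pnorm_of_int_le_1) auto
    also have "\<dots> < 1" using p_gt_1 by simp
    finally show ?thesis .
  qed
  moreover have "pnorm (of_int u * of_int m :: 'a) < 1" if "pnorm (of_int m :: 'a) < 1"
  proof -
    have "pnorm (of_int u * of_int m :: 'a) \<le> 1 * pnorm (of_int m :: 'a)"
      unfolding pnorm_mult by (intro mult_right_mono pnorm_of_int_le_1) auto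
    then show ?thesis using that by simp
  qed
  ultimately show ?thesis
    using pnorm_ultrametric[of "of_int u * of_int m" "of_int v * of_nat p"] uv
      pnorm_of_int_le_1[of m] by force
qed

lemma pnorm_of_nat_coprime:
  assumes "\<not> p dvd m"
  shows "pnorm (of_nat m :: 'a) = 1"
  using pnorm_of_int_coprime[of "int m"] assms by simp

lemma pnorm_of_int_le_iff: "pnorm (of_int m :: 'a) \<le> (1 / real p) ^ N \<longleftrightarrow> int p ^ N dvd m"
proof
  assume "int p ^ N dvd m"
  then obtain k where m: "m = int p ^ N * k" ..
  have "pnorm (of_int m :: 'a) = (1 / real p) ^ N * pnorm (of_int k :: 'a)"
    by (simp add: m pnorm_mult pnorm_power pnorm_p)
  also have "\<dots> \<le> (1 / real p) ^ N * 1"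
    by (intro mult_left_mono pnorm_of_int_le_1) auto
  finally show "pnorm (of_int m :: 'a) \<le> (1 / real p) ^ N" by simp
next
  assume *: "pnorm (of_int m :: 'a) \<le> (1 / real p) ^ N"
  show "int p ^ N dvd m"
    using *
  proof (induction N arbitrary: m)
    case (Suc N)
    have "(1 / real p) ^ Suc N < 1"
      using p_gt_1 by (intro power_Suc_less_one) auto
    then have "int p dvd m"
      using Suc.prems pnorm_of_int_coprime[of m] by fastforce
    then obtain k where k: "m = int p * k" ..
    have "(1 / real p) * pnorm (of_int k :: 'a) \<le> (1 / real p) * (1 / real p) ^ N"
      using Suc.prems by (simp add: k pnorm_mult pnorm_p)
    then have "pnorm (of_int k :: 'a) \<le> (1 / real p) ^ N"
      using p_gt_1 by (subst (asm) mult_le_cancel_left_pos) auto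
    then show ?case
      using Suc.IH by (simp add: k)
  qed auto
qed

lemma pnorm_of_int_dvd_less:
  assumes "int p dvd m"
  shows "pnorm (of_int m :: 'a) < 1"
proof -
  have "pnorm (of_int m :: 'a) \<le> 1 / real p"
    using pnorm_of_int_le_iff[of m 1] assms by simp
  also have "\<dots> < 1" using p_gt_1 by simp
  finally show ?thesis .
qed

lemma pnorm_of_int_cases:
  assumes "m \<noteq> 0"
  obtains k :: nat where "pnorm (of_int m :: 'a) = (1 / real p) ^ k"
proof -
  have "\<not> is_unit (int p)" using p_gt_1 by simp
  then obtain k' where k: "m = int p ^ multiplicity (int p) m * k'" "\<not> int p dvd k'"
    using multiplicity_decompose'[OF assms] by metis
  have "pnorm (of_int m :: 'a) = pnorm (of_int (int p ^ multiplicity (int p) m * k') :: 'a)"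
    using k(1) by simp
  also have "\<dots> = (1 / real p) ^ multiplicity (int p) m"
    using pnorm_of_int_coprime[OF k(2)] by (simp add: pnorm_mult pnorm_power pnorm_p)
  finally show ?thesis by (rule that)
qed

lemma pnorm_rat_cases:
  assumes "z \<in> \<rat>" "z \<noteq> (0 :: 'a)"
  obtains k :: int where "pnorm z = real p powi k"
proof -
  obtain a b where ab: "b > 0" "z = of_int a / of_int b"
    using assms(1) by (auto elim: Rats_cases')
  then have "a \<noteq> 0" using assms(2) by auto
  then obtain k where k: "pnorm (of_int a :: 'a) = (1 / real p) ^ k"
    by (rule pnorm_of_int_cases)
  obtain l where l: "pnorm (of_int b :: 'a) = (1 / real p) ^ l"
    using pnorm_of_int_cases[of b] ab by blast
  have "pnorm z = real p powi (int l - int k)"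
    using p_gt_1
    by (simp add: ab pnorm_divide k l power_int_diff power_one_over field_simps)
  then show ?thesis by (rule that)
qed

lemma padic_ints_pnorm_le:
  assumes "z \<in> (padic_ints :: 'a set)"
  shows "pnorm z \<le> 1"
proof -
  obtain y where y: "y \<in> \<int>" "dist y z < 1"
    using assms unfolding padic_ints_def closure_approachable by (meson zero_less_one)
  then obtain m where "y = of_int m" by (auto elim: Ints_cases)
  then have "pnorm y \<le> 1" by (simp add: pnorm_of_int_le_1)
  with y pnorm_diff_le[of y "y - z"] show ?thesis
    by (simp add: dist_eq_pnorm)
qed

lemma of_int_in_padic_ints: "of_int m \<in> (padic_ints :: 'a set)"
  unfolding padic_ints_def by (intro subsetD[OF closure_subset]) auto

lemma padic_nums_approx:
  assumes "z \<in> (padic_nums :: 'a set)" "e > 0"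
  obtains y where "y \<in> \<rat>" "pnorm (z - y) < e"
  using assms unfolding padic_nums_def closure_approachable
  by (metis dist_commute dist_eq_pnorm)

text \<open>A rational close enough to z has the norm of z, so the closure adds no new
  values.\<close>

lemma padic_nums_pnorm_cases:
  assumes "z \<in> padic_nums" "z \<noteq> (0 :: 'a)"
  obtains k :: int where "pnorm z = real p powi k"
proof -
  obtain y where y: "y \<in> \<rat>" "pnorm (z - y) < pnorm z"
    using padic_nums_approx[OF assms(1), of "pnorm z"] assms(2) by auto
  then have "pnorm y = pnorm z"
    using pnorm_eq_of_diff_less[of y z] by (simp add: pnorm_minus_commute)
  then show ?thesis
    using pnorm_rat_cases[OF y(1)] assms(2) that by (metis pnorm_eq_0_iff)
qed

section \<open>Limits, series and interchange of summations under ultrametric bounds\<close>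

lemma tendsto_iff_pnorm: "(X \<longlongrightarrow> L) F \<longleftrightarrow> ((\<lambda>n. pnorm (X n - L :: 'a)) \<longlongrightarrow> 0) F"
  by (subst tendsto_dist_iff) (simp add: dist_eq_pnorm)

lemma tendsto_iff_eventually_pnorm:
  "(X \<longlongrightarrow> L) F \<longleftrightarrow> (\<forall>e>0. \<forall>\<^sub>F n in F. pnorm (X n - L :: 'a) < e)"
  by (subst tendsto_iff) (simp add: dist_eq_pnorm)

lemma tendsto_add_pnorm:
  fixes X Y :: "'b \<Rightarrow> 'a"
  assumes "(X \<longlongrightarrow> K) F" "(Y \<longlongrightarrow> L) F"
  shows "((\<lambda>n. X n + Y n) \<longlongrightarrow> K + L) F"
  unfolding tendsto_iff_eventually_pnorm
proof (intro allI impI)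
  fix e :: real assume "e > 0"
  then have "\<forall>\<^sub>F n in F. pnorm (X n - K) < e \<and> pnorm (Y n - L) < e"
    using assms by (intro eventually_conj) (auto simp: tendsto_iff_eventually_pnorm)
  then show "\<forall>\<^sub>F n in F. pnorm (X n + Y n - (K + L)) < e"
  proof (rule eventually_mono)
    fix n assume "pnorm (X n - K) < e \<and> pnorm (Y n - L) < e"
    then have "pnorm ((X n - K) + (Y n - L)) < e"
      using pnorm_ultrametric[of "X n - K" "Y n - L"] by linarith
    then show "pnorm (X n + Y n - (K + L)) < e"
      by (simp add: algebra_simps)
  qed
qed

lemma tendsto_mult_left_pnorm:
  fixes X :: "'b \<Rightarrow> 'a"
  assumes "(X \<longlongrightarrow> L) F"
  shows "((\<lambda>n. c * X n) \<longlongrightarrow> c * L) F"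
proof -
  have "((\<lambda>n. pnorm c * pnorm (X n - L)) \<longlongrightarrow> 0) F"
    using assms by (intro tendsto_mult_right_zero) (simp add: tendsto_iff_pnorm[of X])
  then show ?thesis
    by (simp add: tendsto_iff_pnorm[of _ "c * L"] pnorm_mult flip: right_diff_distrib)
qed

lemma tendsto_sum_pnorm:
  fixes X :: "'b \<Rightarrow> 'c \<Rightarrow> 'a"
  assumes "\<And>i. i \<in> A \<Longrightarrow> (X i \<longlongrightarrow> L i) F"
  shows "((\<lambda>n. \<Sum>i\<in>A. X i n) \<longlongrightarrow> (\<Sum>i\<in>A. L i)) F"
  using assms
  by (induction A rule: infinite_finite_induct) (auto intro!: tendsto_add_pnorm)

lemma sums_mult_pnorm:
  assumes "f sums (L :: 'a)"
  shows "(\<lambda>n. c * f n) sums (c * L)"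
  using tendsto_mult_left_pnorm[of _ L sequentially c] assms
  by (simp add: sums_def sum_distrib_left[symmetric])

lemma sums_add_pnorm:
  assumes "f sums (K :: 'a)" "g sums L"
  shows "(\<lambda>n. f n + g n) sums (K + L)"
  using assms by (simp add: sums_def sum.distrib tendsto_add_pnorm)

lemma sums_diff_pnorm:
  assumes "f sums (K :: 'a)" "g sums L"
  shows "(\<lambda>n. f n - g n) sums (K - L)"
  using sums_add_pnorm[OF assms(1) sums_mult_pnorm[OF assms(2), of "- 1"]] by simp

lemma sums_sum_pnorm:
  fixes f :: "'b \<Rightarrow> nat \<Rightarrow> 'a"
  assumes "\<And>i. i \<in> A \<Longrightarrow> f i sums L i"
  shows "(\<lambda>n. \<Sum>i\<in>A. f i n) sums (\<Sum>i\<in>A. L i)"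
  using assms
  by (induction A rule: infinite_finite_induct) (auto intro!: sums_add_pnorm)

lemma sums_Suc_pnorm:
  assumes "(\<lambda>n. f (Suc n)) sums (L :: 'a)"
  shows "f sums (f 0 + L)"
proof -
  have "(\<lambda>n. f 0 + (\<Sum>i<n. f (Suc i))) \<longlonglongrightarrow> f 0 + L"
    using assms by (intro tendsto_add_pnorm) (auto simp: sums_def)
  then have "(\<lambda>n. \<Sum>i<Suc n. f i) \<longlonglongrightarrow> f 0 + L"
    by (simp only: sum.lessThan_Suc_shift)
  then show ?thesis
    unfolding sums_def by (rule LIMSEQ_imp_Suc)
qed

lemma sums_shift_pnorm:
  assumes "(\<lambda>n. f (n + k)) sums (L :: 'a)" "\<And>n. n < k \<Longrightarrow> f n = 0"
  shows "f sums L"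
  using assms
proof (induction k arbitrary: f)
  case (Suc k)
  have "(\<lambda>n. f (Suc n)) sums L"
    using Suc.prems by (intro Suc.IH[of "\<lambda>n. f (Suc n)"]) auto
  then show ?case
    using sums_Suc_pnorm[of f L] Suc.prems(2)[of 0] by simp
qed auto

text \<open>A difference of partial sums is bounded by the largest term between them, so null terms
  already give a Cauchy sequence.\<close>

lemma summable_pnorm_iff: "summable f \<longleftrightarrow> (\<lambda>n. pnorm (f n :: 'a)) \<longlonglongrightarrow> 0"
proof
  assume "summable f"
  then obtain L where L: "(\<lambda>n. \<Sum>i<n. f i) \<longlonglongrightarrow> L"
    by (auto simp: summable_def sums_def)
  have "(\<lambda>n. (\<Sum>i<Suc n. f i) + (- 1) * (\<Sum>i<n. f i)) \<longlonglongrightarrow> L + (- 1) * L"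
    using L by (intro tendsto_add_pnorm tendsto_mult_left_pnorm LIMSEQ_Suc)
  then show "(\<lambda>n. pnorm (f n)) \<longlonglongrightarrow> 0"
    by (simp add: tendsto_iff_pnorm[of f 0] tendsto_iff_pnorm[of _ 0])
next
  assume *: "(\<lambda>n. pnorm (f n)) \<longlonglongrightarrow> 0"
  have "Cauchy (\<lambda>n. \<Sum>i<n. f i)"
  proof (rule metric_CauchyI)
    fix e :: real assume "e > 0"
    then obtain N where N: "\<And>n. n \<ge> N \<Longrightarrow> pnorm (f n) < e"
      using * by (auto simp: lim_sequentially dist_real_def)
    have "pnorm ((\<Sum>i<n. f i) - (\<Sum>i<m. f i)) < e" if "N \<le> m" "m \<le> n" for m n
    proof -
      have "(\<Sum>i<n. f i) - (\<Sum>i<m. f i) = (\<Sum>i\<in>{..<n} - {..<m}. f i)"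
        using that by (subst sum_diff) auto
      then show ?thesis
        using that \<open>e > 0\<close> by (auto intro!: pnorm_sum_less N)
    qed
    then show "\<exists>M. \<forall>m\<ge>M. \<forall>n\<ge>M. dist (\<Sum>i<m. f i) (\<Sum>i<n. f i) < e"
      by (metis dist_eq_pnorm dist_commute linorder_le_cases)
  qed
  then show "summable f"
    by (metis Cauchy_convergent_iff convergent_def sums_def summable_def)
qed

lemma sums_pnorm_le:
  assumes "f sums (L :: 'a)" "\<And>n. pnorm (f n) \<le> B"
  shows "pnorm L \<le> B"
proof (rule ccontr)
  assume "\<not> pnorm L \<le> B"
  then have L: "B < pnorm L" by simp
  have B: "0 \<le> B" using assms(2)[of 0] pnorm_nonneg[of "f 0"] by linarith
  then have "\<forall>\<^sub>F n in sequentially. pnorm ((\<Sum>i<n. f i) - L) < pnorm L"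
    using assms(1) L order.strict_trans1[OF B L] unfolding sums_def tendsto_iff_eventually_pnorm by blast
  then obtain n where "pnorm ((\<Sum>i<n. f i) - L) < pnorm L"
    by (auto simp: eventually_sequentially)
  then have "pnorm L = pnorm (\<Sum>i<n. f i)"
    using pnorm_eq_of_diff_less by metis
  also have "\<dots> \<le> B"
    using assms(2) B by (intro pnorm_sum_le) auto
  finally show False using L by simp
qed

text \<open>Summability is asked of the multiple only: for nonzero c it passes to f, and for
  \<open>c = 0\<close> both sides are 0 whatever value the sum of f takes.\<close>

lemma suminf_mult_pnorm:
  assumes "summable (\<lambda>n. c * f n :: 'a)"
  shows "(\<Sum>n. c * f n) = c * (\<Sum>n. f n)"
proof (cases "c = 0")
  case False
  then have "f sums (inverse c * (\<Sum>n. c * f n))"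
    using sums_mult_pnorm[OF summable_sums[OF assms], of "inverse c"] by (simp flip: mult.assoc)
  then show ?thesis
    using False by (simp add: sums_iff flip: mult.assoc)
qed simp

text \<open>Dominated convergence, where \<beta> need only tend to 0: beyond some J all terms are
  uniformly small, and an ultrametric sum of small terms stays small. The finitely many terms before
  J converge one by one.\<close>

lemma tannery_pnorm:
  fixes t :: "nat \<Rightarrow> nat \<Rightarrow> 'a"
  assumes bound: "\<And>N j. pnorm (t N j) \<le> \<beta> j"
    and \<beta>: "\<beta> \<longlonglongrightarrow> 0"
    and lim: "\<And>j. (\<lambda>N. t N j) \<longlonglongrightarrow> T j"
  shows "summable T" "(\<lambda>N. \<Sum>j. t N j) \<longlonglongrightarrow> (\<Sum>j. T j)"
proof -
  have bT: "pnorm (T j) \<le> \<beta> j" for j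
  proof (rule ccontr)
    assume *: "\<not> pnorm (T j) \<le> \<beta> j"
    then have "0 < pnorm (T j)"
      using bound[of 0 j] pnorm_nonneg[of "t 0 j"] by linarith
    then have "\<forall>\<^sub>F N in sequentially. pnorm (t N j - T j) < pnorm (T j)"
      using lim[of j] unfolding tendsto_iff_eventually_pnorm by blast
    then obtain N where "pnorm (t N j - T j) < pnorm (T j)"
      by (auto simp: eventually_sequentially)
    then show False
      using pnorm_eq_of_diff_less bound[of N j] * by metis
  qed
  have st: "summable (t N)" for N
    unfolding summable_pnorm_iff
    by (rule LIMSEQ_zero_dominated[OF _ _ \<beta>]) (auto simp: bound)
  show sT: "summable T"
    unfolding summable_pnorm_iff
    by (rule LIMSEQ_zero_dominated[OF _ _ \<beta>]) (auto simp: bT)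
  show "(\<lambda>N. \<Sum>j. t N j) \<longlonglongrightarrow> (\<Sum>j. T j)"
    unfolding tendsto_iff_eventually_pnorm
  proof (intro allI impI)
    fix e :: real assume "e > 0"
    then obtain J where J: "\<And>j. j \<ge> J \<Longrightarrow> \<beta> j < e / 2"
      using \<beta> unfolding lim_sequentially dist_real_def
      by (metis abs_less_iff diff_zero half_gt_zero)
    have "\<forall>\<^sub>F N in sequentially. \<forall>j\<in>{..<J}. pnorm (t N j - T j) < e / 2"
      using lim half_gt_zero[OF \<open>e > 0\<close>] unfolding tendsto_iff_eventually_pnorm
      by (intro eventually_ball_finite ballI finite_lessThan) blast
    then show "\<forall>\<^sub>F N in sequentially. pnorm ((\<Sum>j. t N j) - (\<Sum>j. T j)) < e"
    proof (rule eventually_mono)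
      fix N assume N: "\<forall>j\<in>{..<J}. pnorm (t N j - T j) < e / 2"
      have "pnorm ((\<Sum>j. t N j) - (\<Sum>j. T j)) \<le> e / 2"
      proof (rule sums_pnorm_le)
        show "(\<lambda>j. t N j - T j) sums ((\<Sum>j. t N j) - (\<Sum>j. T j))"
          by (intro sums_diff_pnorm summable_sums st sT)
        fix j
        show "pnorm (t N j - T j) \<le> e / 2"
        proof (cases "j < J")
          case False
          then show ?thesis
            using pnorm_diff_le[of "t N j" "T j"] bound[of N j] bT[of j] J[of j] by simp
        qed (use N in force)
      qed
      then show "pnorm ((\<Sum>j. t N j) - (\<Sum>j. T j)) < e" using \<open>e > 0\<close> by simp
    qed
  qed
qed

text \<open>Dominated convergence for the rows cut off at \<open>k < K\<close>: each cut row is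
  eventually the full finite row, and its sum over n is a finite sum of columns.\<close>

lemma triangular_interchange:
  fixes a :: "nat \<Rightarrow> nat \<Rightarrow> 'a"
  assumes bound: "\<And>n k. pnorm (a n k) \<le> \<beta> n"
    and \<beta>: "\<beta> \<longlonglongrightarrow> 0"
    and zero: "\<And>n k. k > n \<Longrightarrow> a n k = 0"
  shows "summable (\<lambda>n. a n k)" "(\<lambda>k. \<Sum>n. a n k) sums (\<Sum>n. \<Sum>k\<le>n. a n k)"
proof -
  show *: "summable (\<lambda>n. a n k)" for k
    unfolding summable_pnorm_iff
    by (rule LIMSEQ_zero_dominated[OF _ _ \<beta>]) (auto simp: bound)
  have \<beta>0: "0 \<le> \<beta> n" for n
    using bound[of n 0] pnorm_nonneg[of "a n 0"] by linarith
  have "(\<lambda>K. \<Sum>n. \<Sum>k<K. a n k) \<longlonglongrightarrow> (\<Sum>n. \<Sum>k\<le>n. a n k)"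
  proof (rule tannery_pnorm(2)[OF _ \<beta>])
    show "pnorm (\<Sum>k<N. a n k) \<le> \<beta> n" for N n
      by (intro pnorm_sum_le bound \<beta>0)
    show "(\<lambda>N. \<Sum>k<N. a n k) \<longlonglongrightarrow> (\<Sum>k\<le>n. a n k)" for n
    proof (rule tendsto_eventually)
      show "\<forall>\<^sub>F N in sequentially. (\<Sum>k<N. a n k) = (\<Sum>k\<le>n. a n k)"
        using eventually_gt_at_top[of n]
        by eventually_elim (auto intro!: sum.mono_neutral_right zero)
    qed
  qed
  moreover have "(\<Sum>n. \<Sum>k<K. a n k) = (\<Sum>k<K. \<Sum>n. a n k)" for K
    by (intro sums_unique[symmetric] sums_sum_pnorm summable_sums *)
  ultimately show "(\<lambda>k. \<Sum>n. a n k) sums (\<Sum>n. \<Sum>k\<le>n. a n k)"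
    by (simp add: sums_def)
qed

end

section \<open>Binomial series\<close>

context padic_complex
begin

lemma padic_pow_sums:
  assumes "binom_null s \<rho>" "pnorm z \<le> \<rho>"
  shows "(\<lambda>n. (s gchoose n) * z ^ n) sums (padic_pow (1 + z) s :: 'a)"
proof -
  have "pnorm ((s gchoose n) * z ^ n) \<le> pnorm (s gchoose n) * \<rho> ^ n" for n
    unfolding pnorm_mult pnorm_power
    by (intro mult_left_mono power_mono assms) auto
  then have "summable (\<lambda>n. (s gchoose n) * z ^ n)"
    using assms(1) unfolding summable_pnorm_iff binom_null_def
    by (rule LIMSEQ_zero_dominated[OF pnorm_nonneg])
  then show ?thesis
    unfolding padic_pow_def by (simp add: summable_sums)
qed

text \<open>Absorption, \<open>s * (s - 1 gchoose n) = Suc n * (s gchoose Suc n)\<close>, together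
  with the norm of \<open>Suc n\<close> being at most 1. It requires division by s; for
  \<open>s = 0\<close> the coefficients are plus or minus 1 and \<open>\<rho> < 1\<close> is used
  instead.\<close>

lemma binom_null_minus_one:
  assumes "binom_null (s :: 'a) \<rho>" "0 < \<rho>" "\<rho> < 1"
  shows "binom_null (s - 1) \<rho>"
proof (cases "s = 0")
  case True
  have "(- 1 :: 'a) gchoose n = (- 1) ^ n" for n
    using gbinomial_negated_upper[of "- 1 :: 'a" n] binomial_gbinomial[of n n, where 'a = 'a]
    by simp
  then show ?thesis
    using True assms by (simp add: binom_null_def pnorm_power LIMSEQ_power_zero)
next
  case False
  have "(\<lambda>n. pnorm (s gchoose Suc n) * \<rho> ^ Suc n * (1 / (pnorm s * \<rho>))) \<longlonglongrightarrow> 0"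
    using assms(1) unfolding binom_null_def by (intro tendsto_mult_left_zero LIMSEQ_Suc)
  moreover have "pnorm (s - 1 gchoose n) * \<rho> ^ n
      \<le> pnorm (s gchoose Suc n) * \<rho> ^ Suc n * (1 / (pnorm s * \<rho>))" for n
  proof -
    have "pnorm s * pnorm (s - 1 gchoose n) = pnorm (of_nat (Suc n) :: 'a) * pnorm (s gchoose Suc n)"
      by (simp only: gbinomial_absorption flip: pnorm_mult)
    also have "\<dots> \<le> 1 * pnorm (s gchoose Suc n)"
      by (intro mult_right_mono pnorm_of_nat_le_1) auto
    finally have "pnorm s * pnorm (s - 1 gchoose n) * \<rho> ^ n \<le> pnorm (s gchoose Suc n) * \<rho> ^ n"
      using assms by (intro mult_right_mono) auto
    then show ?thesis
      using False assms by (simp add: field_simps)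
  qed
  ultimately show ?thesis
    unfolding binom_null_def using assms by (auto intro: LIMSEQ_zero_dominated[rotated 2])
qed

lemma binom_null_add_one:
  assumes "binom_null (s :: 'a) \<rho>" "0 \<le> \<rho>"
  shows "binom_null (s + 1) \<rho>"
proof -
  let ?f = "\<lambda>n. pnorm (s gchoose n) * \<rho> ^ n"
  have "(\<lambda>n. ?f n * \<rho> + ?f (Suc n)) \<longlonglongrightarrow> 0"
    using assms(1) unfolding binom_null_def
    by (intro tendsto_add_zero tendsto_mult_left_zero LIMSEQ_Suc)
  moreover have "pnorm (s + 1 gchoose Suc n) * \<rho> ^ Suc n \<le> ?f n * \<rho> + ?f (Suc n)" for n
  proof -
    have "pnorm (s + 1 gchoose Suc n) \<le> pnorm (s gchoose n) + pnorm (s gchoose Suc n)"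
      unfolding gbinomial_Suc_Suc
      using pnorm_ultrametric[of "s gchoose n" "s gchoose Suc n"]
        pnorm_nonneg[of "s gchoose n"] pnorm_nonneg[of "s gchoose Suc n"] by linarith
    then have "pnorm (s + 1 gchoose Suc n) * \<rho> ^ Suc n
        \<le> (pnorm (s gchoose n) + pnorm (s gchoose Suc n)) * \<rho> ^ Suc n"
      using assms by (intro mult_right_mono) auto
    then show ?thesis by (simp add: algebra_simps)
  qed
  ultimately have "(\<lambda>n. pnorm (s + 1 gchoose Suc n) * \<rho> ^ Suc n) \<longlonglongrightarrow> 0"
    using assms by (auto intro: LIMSEQ_zero_dominated[rotated 2])
  then show ?thesis
    unfolding binom_null_def by (rule LIMSEQ_imp_Suc)
qed

text \<open>Pascal's rule, applied term by term to the series with exponent \<open>s - 1\<close>. It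
  later produces the exponent \<open>s - 1\<close> in front of the expansion.\<close>

lemma padic_pow_step:
  assumes "binom_null s \<rho>" "0 < \<rho>" "\<rho> < 1" "pnorm z \<le> \<rho>"
  shows "padic_pow (1 + z) s = (1 + z) * (padic_pow (1 + z) (s - 1) :: 'a)"
proof -
  let ?g = "\<lambda>n. (s - 1 gchoose n) * z ^ n"
  let ?P = "padic_pow (1 + z) (s - 1)"
  have g: "?g sums ?P"
    by (rule padic_pow_sums[OF binom_null_minus_one[OF assms(1-3)] assms(4)])
  have "(\<lambda>n. if n = 0 then 0 else z * ?g (n - 1)) sums (0 + z * ?P)"
    using sums_Suc_pnorm[of "\<lambda>n. if n = 0 then 0 else z * ?g (n - 1)"] sums_mult_pnorm[OF g, of z]
    by simp
  from sums_add_pnorm[OF g this]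
  have "(\<lambda>n. ?g n + (if n = 0 then 0 else z * ?g (n - 1))) sums (?P + z * ?P)"
    by simp
  also have "(\<lambda>n. ?g n + (if n = 0 then 0 else z * ?g (n - 1))) = (\<lambda>n. (s gchoose n) * z ^ n)"
  proof
    fix n
    show "?g n + (if n = 0 then 0 else z * ?g (n - 1)) = (s gchoose n) * z ^ n"
    proof (cases n)
      case (Suc m)
      have "s gchoose Suc m = (s - 1 gchoose m) + (s - 1 gchoose Suc m)"
        using gbinomial_reduce_nat[of "Suc m" s] by simp
      then show ?thesis by (simp only: Suc) (simp add: algebra_simps)
    qed simp
  qed
  finally have "(\<lambda>n. (s gchoose n) * z ^ n) sums (?P + z * ?P)" .
  then show ?thesis
    using padic_pow_sums[OF assms(1,4)] by (simp add: sums_iff algebra_simps)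
qed

lemma padic_pow_minus_of_nat:
  assumes "binom_null s \<rho>" "0 < \<rho>" "\<rho> < 1" "pnorm z \<le> \<rho>"
  shows "binom_null (s - of_nat k) \<rho>"
    and "padic_pow (1 + z) s = (1 + z) ^ k * (padic_pow (1 + z) (s - of_nat k) :: 'a)"
proof (induction k)
  case (Suc k)
  {
    case 1
    show ?case
      using binom_null_minus_one[OF Suc(1)] assms by (simp add: algebra_simps)
  next
    case 2
    show ?case
      using Suc(2) padic_pow_step[OF Suc(1) assms(2-4)] by (simp add: algebra_simps)
  }
qed (use assms in auto)

text \<open>Expanding \<open>z + t (1 + z)\<close> in powers of \<open>t\<close>, the coefficient of \<open>t\<^sup>k\<close> becomes
  a binomial series for the exponent \<open>s - k\<close>.\<close>

lemma padic_pow_mult: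
  assumes s: "binom_null s \<rho>" and \<rho>: "0 < \<rho>" "\<rho> < 1"
    and z: "pnorm z \<le> \<rho>" and t: "pnorm t \<le> \<rho>"
  shows "padic_pow ((1 + z) * (1 + t)) s = padic_pow (1 + z) s * (padic_pow (1 + t) s :: 'a)"
proof -
  define a where
    "a n k = (s gchoose n) * (of_nat (n choose k) * (t * (1 + z)) ^ k * z ^ (n - k))" for n k
  have z1: "pnorm (1 + z) \<le> 1"
    using pnorm_ultrametric[of 1 z] z \<rho> by simp
  have tz: "pnorm (t * (1 + z)) \<le> \<rho>"
    using mult_mono[OF t z1] \<rho> by (simp add: pnorm_mult)
  have "z + t * (1 + z) = (1 + z) * (1 + t) - 1"
    by (simp add: algebra_simps)
  then have zt: "pnorm ((1 + z) * (1 + t) - 1) \<le> \<rho>"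
    using pnorm_ultrametric[of z "t * (1 + z)"] tz z by simp
  have row: "(\<Sum>k\<le>n. a n k) = (s gchoose n) * ((1 + z) * (1 + t) - 1) ^ n" for n
  proof -
    have "(\<Sum>k\<le>n. a n k) = (s gchoose n) * (t * (1 + z) + z) ^ n"
      unfolding a_def binomial_ring sum_distrib_left ..
    then show ?thesis by (simp add: algebra_simps)
  qed
  have bound: "pnorm (a n k) \<le> pnorm (s gchoose n) * \<rho> ^ n" for n k
  proof (cases "k \<le> n")
    case True
    have "pnorm (of_nat (n choose k) * (t * (1 + z)) ^ k * z ^ (n - k)) \<le> 1 * \<rho> ^ k * \<rho> ^ (n - k)"
      unfolding pnorm_mult[of _ "z ^ (n - k)"] pnorm_mult[of _ "(t * (1 + z)) ^ k"] pnorm_power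
      using \<rho> by (intro mult_mono power_mono pnorm_of_nat_le_1 tz z mult_nonneg_nonneg zero_le_power) auto
    also have "\<dots> = \<rho> ^ n"
      using True by (simp flip: power_add)
    finally show ?thesis
      unfolding a_def pnorm_mult[of "s gchoose n"] by (intro mult_left_mono) auto
  qed (use \<rho> in \<open>auto simp: a_def binomial_eq_0\<close>)
  have col: "(\<lambda>n. a n k) sums ((s gchoose k) * t ^ k * padic_pow (1 + z) s)" for k
  proof (rule sums_shift_pnorm)
    show "a n k = 0" if "n < k" for n
      using that by (simp add: a_def binomial_eq_0)
    have "(\<lambda>m. (s gchoose k) * (t * (1 + z)) ^ k * ((s - of_nat k gchoose m) * z ^ m)) sums
        ((s gchoose k) * (t * (1 + z)) ^ k * padic_pow (1 + z) (s - of_nat k))"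
      by (intro sums_mult_pnorm padic_pow_sums[OF _ z] padic_pow_minus_of_nat[OF s \<rho> z])
    \<comment> \<open>The factor \<open>(1 + z) ^ k\<close> raises the exponent from
      \<open>s - k\<close> back to s, so the power of \<open>1 + z\<close> no longer depends on the
      column.\<close>
    also have "(s gchoose k) * (t * (1 + z)) ^ k * padic_pow (1 + z) (s - of_nat k) =
        (s gchoose k) * t ^ k * padic_pow (1 + z) s"
      by (subst padic_pow_minus_of_nat(2)[OF s \<rho> z, of k]) (simp add: power_mult_distrib)
    also have "(\<lambda>m. (s gchoose k) * (t * (1 + z)) ^ k * ((s - of_nat k gchoose m) * z ^ m)) =
        (\<lambda>m. a (m + k) k)"
    proof
      fix m
      have "(s gchoose (m + k)) * of_nat (m + k choose k) = (s gchoose k) * (s - of_nat k gchoose m)"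
        using gbinomial_trinomial_revision[of k "m + k" s]
        by (simp add: binomial_gbinomial)
      then show "(s gchoose k) * (t * (1 + z)) ^ k * ((s - of_nat k gchoose m) * z ^ m) = a (m + k) k"
        unfolding a_def by (simp add: ac_simps)
    qed
    finally show "(\<lambda>n. a (n + k) k) sums ((s gchoose k) * t ^ k * padic_pow (1 + z) s)" .
  qed
  have "(\<lambda>k. \<Sum>n. a n k) sums (\<Sum>n. \<Sum>k\<le>n. a n k)"
    using s unfolding binom_null_def
    by (intro triangular_interchange(2)[where \<beta> = "\<lambda>n. pnorm (s gchoose n) * \<rho> ^ n"] bound)
      (auto simp: a_def binomial_eq_0)
  moreover have "(\<Sum>n. \<Sum>k\<le>n. a n k) = padic_pow ((1 + z) * (1 + t)) s"
    by (simp add: row padic_pow_def)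
  moreover have "(\<lambda>k. \<Sum>n. a n k) = (\<lambda>k. padic_pow (1 + z) s * ((s gchoose k) * t ^ k))"
    using col by (auto simp: sums_iff fun_eq_iff algebra_simps)
  ultimately show ?thesis
    using sums_mult_pnorm[OF padic_pow_sums[OF s t], of "padic_pow (1 + z) s"]
    by (simp add: sums_iff)
qed

section \<open>Norms of factorials and of binomial coefficients\<close>

lemma pnorm_fact_div: "pnorm (fact n :: 'a) = (1 / real p) ^ (n div p) * pnorm (fact (n div p) :: 'a)"
proof (induction n)
  case (Suc n)
  have *: "pnorm (fact (Suc n) :: 'a) = pnorm (of_nat (Suc n) :: 'a) * pnorm (fact n :: 'a)"
    by (simp only: fact_Suc of_nat_mult pnorm_mult of_nat_fact)
  show ?case
  proof (cases "p dvd Suc n")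
    case True
    then obtain j where j: "Suc n = p * j" ..
    have d: "Suc n div p = j" using j p_gt_1 by simp
    then have "Suc (n div p) = j"
      using True by (simp add: div_Suc dvd_eq_mod_eq_0)
    then have "fact j = (of_nat j * fact (n div p) :: 'a)" by auto
    moreover have "pnorm (of_nat (Suc n) :: 'a) = (1 / real p) * pnorm (of_nat j :: 'a)"
      unfolding j by (simp add: pnorm_mult pnorm_p)
    moreover have "(1 / real p) ^ j = (1 / real p) * (1 / real p) ^ (n div p)"
      using \<open>Suc (n div p) = j\<close> by auto
    ultimately show ?thesis
      unfolding * d using Suc by (simp add: pnorm_mult)
  next
    case False
    then show ?thesis
      unfolding * using Suc pnorm_of_nat_coprime[OF False]
      by (simp add: div_Suc dvd_eq_mod_eq_0 del: of_nat_Suc)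
  qed
qed simp

text \<open>Legendre's bound v(n!) \<le> n/(p - 1), by descent from n to \<open>n div p\<close>. The
  constant c is the (p-1)-th root of 1/p: each factor 1/p split off from the multiples of p accounts
  for \<open>p - 1\<close> factors c, and one more is left for the remaining factorial.\<close>

lemma pnorm_fact_ge: "(real p powr (- 1 / (real p - 1))) ^ n \<le> pnorm (fact n :: 'a)"
proof (induction n rule: less_induct)
  case (less n)
  define c where "c = real p powr (- 1 / (real p - 1))"
  have c: "0 < c" "c \<le> 1"
    using p_gt_1 powr_mono[of "- 1 / (real p - 1)" 0 "real p"] by (auto simp: c_def)
  have cp: "c ^ (p - 1) = 1 / real p"
  proof -
    have "c ^ (p - 1) = real p powr (- 1 / (real p - 1) * real (p - 1))"
      using p_gt_1 unfolding c_def by (simp only: powr_power)  (simp add: powr_powr flip: powr_realpow)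
    also have "- 1 / (real p - 1) * real (p - 1) = - 1"
      using p_gt_1 by (simp add: of_nat_diff field_simps)
    finally show ?thesis
      using p_gt_1 by (simp add: powr_minus_divide)
  qed
  show ?case
  proof (cases "n = 0")
    case False
    then have "n div p < n" using p_gt_1 by simp
    from less.IH[OF this] have IH: "c ^ (n div p) \<le> pnorm (fact (n div p) :: 'a)"
      by (simp add: c_def)
    have "c ^ n \<le> c ^ ((p - 1) * (n div p) + n div p)"
    proof (rule power_decreasing)
      have "(p - 1) * (n div p) + n div p = p * (n div p)"
        using p_gt_1 by (cases p) auto
      then show "(p - 1) * (n div p) + n div p \<le> n" by simp
    qed (use c in auto)
    also have "\<dots> = (1 / real p) ^ (n div p) * c ^ (n div p)"
      by (simp only: power_add power_mult cp)
    also have "\<dots> \<le> (1 / real p) ^ (n div p) * pnorm (fact (n div p) :: 'a)"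
      by (intro mult_left_mono IH) auto
    also have "\<dots> = pnorm (fact n :: 'a)"
      by (rule pnorm_fact_div[symmetric])
    finally show ?thesis by (simp add: c_def)
  qed simp
qed

lemma pnorm_gbinomial: "pnorm (s gchoose n :: 'a) = (\<Prod>i<n. pnorm (s - of_nat i)) / pnorm (fact n :: 'a)"
proof -
  have "pnorm (s gchoose n) * pnorm (fact n :: 'a) = (\<Prod>i<n. pnorm (s - of_nat i))"
    by (simp only: gbinomial_mult_fact' pnorm_prod atLeast0LessThan flip: pnorm_mult)
  then show ?thesis
    by (simp add: eq_divide_eq)
qed

text \<open>The numerator of the binomial coefficient is at most \<open>\<sigma> ^ n\<close>, the
  factorial at least \<open>c ^ n\<close>, so a geometric sequence of ratio
  \<open>\<sigma> * \<rho> / c < 1\<close> dominates.\<close>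

lemma binom_null_of_bound:
  assumes "\<And>k. pnorm (s - of_nat k :: 'a) \<le> \<sigma>" "0 \<le> \<rho>"
    and "\<sigma> * \<rho> < real p powr (- 1 / (real p - 1))"
  shows "binom_null s \<rho>"
proof -
  define c where "c = real p powr (- 1 / (real p - 1))"
  have c: "0 < c" using p_gt_1 by (simp add: c_def)
  have \<sigma>: "0 \<le> \<sigma>" using assms(1)[of 0] by (rule order.trans[OF pnorm_nonneg])
  have "(\<lambda>n. (\<sigma> * \<rho> / c) ^ n) \<longlonglongrightarrow> 0"
    using assms c \<sigma> by (intro LIMSEQ_power_zero) (simp add: c_def)
  moreover have "pnorm (s gchoose n) * \<rho> ^ n \<le> (\<sigma> * \<rho> / c) ^ n" for n
  proof -
    have "pnorm (s gchoose n) \<le> \<sigma> ^ n / c ^ n"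
      unfolding pnorm_gbinomial c_def
    proof (rule frac_le)
      have "(\<Prod>i<n. pnorm (s - of_nat i)) \<le> (\<Prod>i<n. \<sigma>)"
        by (intro prod_mono) (auto intro: assms)
      then show "(\<Prod>i<n. pnorm (s - of_nat i)) \<le> \<sigma> ^ n" by simp
    qed (use pnorm_fact_ge c \<sigma> in \<open>auto simp: c_def\<close>)
    then have "pnorm (s gchoose n) * \<rho> ^ n \<le> \<sigma> ^ n / c ^ n * \<rho> ^ n"
      using assms by (intro mult_right_mono) auto
    then show ?thesis by (simp add: power_divide power_mult_distrib)
  qed
  ultimately show ?thesis
    unfolding binom_null_def using assms by (auto intro: LIMSEQ_zero_dominated[rotated 2])
qed

text \<open>A factor can exceed 1 only at a multiple \<open>i = p ^ M * j\<close>, where it equals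
  the inverse of the norm of j; these j run up to \<open>n div p ^ M\<close>.\<close>

lemma prod_max_eq_fact_div:
  "(\<Prod>i=1..n. max 1 ((1 / real p) ^ M / pnorm (of_nat i :: 'a))) = 1 / pnorm (fact (n div p ^ M) :: 'a)"
proof (induction n)
  case (Suc n)
  let ?q = "p ^ M"
  have iff: "pnorm (of_nat (Suc n) :: 'a) \<le> (1 / real p) ^ M \<longleftrightarrow> ?q dvd Suc n"
    using pnorm_of_int_le_iff[of "int (Suc n)" M]
    by (simp only: of_int_of_nat_eq of_nat_dvd_iff flip: of_nat_power)
  have pos: "pnorm (of_nat (Suc n) :: 'a) > 0"
    by (simp del: of_nat_Suc)
  have *: "(\<Prod>i=1..Suc n. max 1 ((1 / real p) ^ M / pnorm (of_nat i :: 'a))) =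
      1 / pnorm (fact (n div ?q) :: 'a) * max 1 ((1 / real p) ^ M / pnorm (of_nat (Suc n) :: 'a))"
    using Suc by (simp add: mult.commute del: of_nat_Suc)
  show ?case
  proof (cases "?q dvd Suc n")
    case True
    then obtain j where j: "Suc n = ?q * j" ..
    have d: "Suc n div ?q = j" using j p_gt_1 by simp
    then have Sj: "Suc (n div ?q) = j"
      using True by (simp add: div_Suc dvd_eq_mod_eq_0)
    then have f: "fact j = (of_nat j * fact (n div ?q) :: 'a)" by auto
    have "pnorm (of_nat (Suc n) :: 'a) = (1 / real p) ^ M * pnorm (of_nat j :: 'a)"
      unfolding j by (simp add: pnorm_mult pnorm_power pnorm_p)
    then have "(1 / real p) ^ M / pnorm (of_nat (Suc n) :: 'a) = 1 / pnorm (of_nat j :: 'a)"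
      using p_gt_1 by (simp del: of_nat_Suc)
    moreover have "1 \<le> 1 / pnorm (of_nat j :: 'a)"
      using Sj pnorm_of_nat_le_1[of j] by (subst le_divide_eq) auto
    ultimately have "max 1 ((1 / real p) ^ M / pnorm (of_nat (Suc n) :: 'a)) = 1 / pnorm (of_nat j :: 'a)"
      by (simp only: max.absorb2)
    then show ?thesis
      unfolding * d f by (simp add: pnorm_mult)
  next
    case False
    then have "max 1 ((1 / real p) ^ M / pnorm (of_nat (Suc n) :: 'a)) = 1"
      using iff pos by (auto simp: max_def divide_le_eq_1_pos simp del: of_nat_Suc)
    then show ?thesis
      unfolding * using False by (simp add: div_Suc dvd_eq_mod_eq_0)
  qed
qed simp

text \<open>Each numerator \<open>h - i\<close> with i positive is paired with the denominator i,
  and its norm is at most the maximum of \<open>(1 / p) ^ M\<close> and that of i. The numerator h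
  is left over and goes with the last denominator. Thus only denominators divisible by
  \<open>p ^ M\<close> can enlarge the coefficient.\<close>

lemma pnorm_gbinomial_small:
  assumes h: "pnorm (h :: 'a) \<le> (1 / real p) ^ M"
  shows "pnorm (h gchoose n) \<le> 1 / pnorm (fact (n div p ^ M) :: 'a)"
proof (cases n)
  case (Suc m)
  let ?q = "(1 / real p) ^ M"
  let ?F = "\<lambda>m. \<Prod>i=1..m. max 1 (?q / pnorm (of_nat i :: 'a))"
  have "pnorm (h gchoose Suc m) \<le> ?F m * (?q / pnorm (of_nat (Suc m) :: 'a))"
  proof (induction m)
    case 0
    then show ?case using h by simp
  next
    case (Suc m)
    let ?m = "pnorm (of_nat (Suc m) :: 'a)"
    have pos: "?m > 0" by (simp del: of_nat_Suc)
    have "pnorm (h - of_nat (Suc m)) \<le> max ?q ?m"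
      using pnorm_diff_le[of h "of_nat (Suc m)"] h by linarith
    then have "pnorm (h gchoose Suc (Suc m)) \<le>
        (?F m * (?q / ?m)) * max ?q ?m / pnorm (of_nat (Suc (Suc m)) :: 'a)"
      unfolding gbinomial_Suc_mult[of h "Suc m"] pnorm_divide pnorm_mult[of "h gchoose Suc m"]
      using Suc
      by (intro divide_right_mono mult_mono)
        (auto intro!: mult_nonneg_nonneg divide_nonneg_nonneg prod_nonneg simp: le_max_iff_disj
          simp del: of_nat_Suc)
    also have "\<dots> = ?F m * (max ?q ?m / ?m) * (?q / pnorm (of_nat (Suc (Suc m)) :: 'a))"
      by simp
    also have "max ?q ?m / ?m = max 1 (?q / ?m)"
      using pos p_gt_1 by (auto simp: max_def field_simps)
    also have "?F m * max 1 (?q / ?m) = ?F (Suc m)"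
      by (simp add: mult_ac del: of_nat_Suc)
    finally show ?case .
  qed
  also have "\<dots> \<le> ?F (Suc m)"
    by (subst prod.nat_ivl_Suc', simp, subst mult.commute, rule mult_right_mono)
      (auto intro!: prod_nonneg simp del: of_nat_Suc)
  also have "\<dots> = 1 / pnorm (fact (n div p ^ M) :: 'a)"
    unfolding Suc by (rule prod_max_eq_fact_div)
  finally show ?thesis by (simp add: Suc)
qed simp

text \<open>For exponents h close to 0 the coefficient grows at most by a factor 1/c per block of
  \<open>q = p ^ M\<close> indices, while \<open>\<rho> ^ n\<close> shrinks by
  \<open>\<rho> ^ q\<close>; M is chosen such that the latter wins. Adding 1 to the exponent moves
  the result to a ball about 1.\<close>

lemma binom_null_near_one:
  assumes \<rho>: "0 < \<rho>" "\<rho> < 1"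
  shows "\<exists>r>0. \<forall>s\<in>ball (1 :: 'a) r. binom_null s \<rho>"
proof -
  define c where "c = real p powr (- 1 / (real p - 1))"
  have c: "0 < c" using p_gt_1 by (simp add: c_def)
  have "(\<lambda>M. \<rho> ^ M) \<longlonglongrightarrow> 0"
    using \<rho> by (intro LIMSEQ_power_zero) auto
  then obtain M where M: "\<rho> ^ M < c"
    using c \<rho> by (auto simp: lim_sequentially dist_real_def)
  define q where "q = p ^ M"
  have q: "q > 0" "M \<le> q"
    using p_gt_1 by (auto simp: q_def intro: less_imp_le less_exp power_gt_expt)
  have \<rho>q: "\<rho> ^ q < c"
    using power_decreasing[OF q(2), of \<rho>] \<rho> M by linarith
  have "binom_null (1 + h) \<rho>" if h: "pnorm h < (1 / real p) ^ M" for h :: 'a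
  proof -
    have "pnorm (h gchoose n) * \<rho> ^ n \<le> (\<rho> ^ q / c) ^ (n div q)" for n
    proof -
      have "pnorm (h gchoose n) \<le> 1 / pnorm (fact (n div q) :: 'a)"
        using pnorm_gbinomial_small[of h M n] h by (simp add: q_def)
      also have "\<dots> \<le> 1 / c ^ (n div q)"
        using pnorm_fact_ge[of "n div q"] c by (intro frac_le) (auto simp: c_def)
      finally have "pnorm (h gchoose n) \<le> 1 / c ^ (n div q)" .
      moreover have "\<rho> ^ n \<le> \<rho> ^ (q * (n div q))"
        using \<rho> by (intro power_decreasing) auto
      ultimately have "pnorm (h gchoose n) * \<rho> ^ n \<le> 1 / c ^ (n div q) * \<rho> ^ (q * (n div q))"
        using \<rho> c by (intro mult_mono) auto
      then show ?thesis by (simp add: power_divide power_mult)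
    qed
    moreover have "(\<lambda>n. (\<rho> ^ q / c) ^ (n div q)) \<longlonglongrightarrow> 0"
    proof (rule filterlim_compose[of "\<lambda>n. (\<rho> ^ q / c) ^ n"])
      show "(\<lambda>n. (\<rho> ^ q / c) ^ n) \<longlonglongrightarrow> 0"
        using \<rho>q c \<rho> by (intro LIMSEQ_power_zero) auto
      show "filterlim (\<lambda>n. n div q) sequentially sequentially"
        unfolding filterlim_at_top
      proof
        fix Z
        show "\<forall>\<^sub>F n in sequentially. Z \<le> n div q"
          using eventually_ge_at_top[of "Z * q"]
          by eventually_elim (use q in \<open>simp add: less_eq_div_iff_mult_less_eq\<close>)
      qed
    qed
    ultimately have "binom_null h \<rho>"
      unfolding binom_null_def using \<rho> by (auto intro: LIMSEQ_zero_dominated[rotated 2])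
    then show ?thesis
      using binom_null_add_one[of h \<rho>] \<rho> by (simp add: add.commute)
  qed
  then have "\<forall>s\<in>ball (1 :: 'a) ((1 / real p) ^ M). binom_null s \<rho>"
    using dist_eq_pnorm pnorm_minus_commute by (metis add_diff_cancel_left' diff_add_cancel add.commute mem_ball)
  then show ?thesis
    using p_gt_1 by (intro exI[of _ "(1 / real p) ^ M"]) auto
qed

text \<open>The right-hand side is the product of the Gauss norms, for radius h, of the linear
  factors of the binomial polynomial, divided by the norm of the factorial; Gauss norms are
  submultiplicative.\<close>

lemma pnorm_coeff_shifted_binom_poly:
  assumes "0 \<le> h"
  shows "pnorm (coeff (shifted_binom_poly n) k :: 'a) * h ^ k
    \<le> (\<Prod>i<n. max h (pnorm (1 - of_nat i :: 'a))) / pnorm (fact n :: 'a)"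
proof (induction n arbitrary: k)
  case 0
  then show ?case by (auto simp: coeff_1)
next
  case (Suc n)
  let ?B = "shifted_binom_poly n :: 'a poly"
  let ?m = "max h (pnorm (1 - of_nat n :: 'a))"
  let ?G = "\<lambda>n. (\<Prod>i<n. max h (pnorm (1 - of_nat i :: 'a))) / pnorm (fact n :: 'a)"
  have G: "?G n \<ge> 0" using assms by (intro divide_nonneg_nonneg prod_nonneg) auto
  have 1: "pnorm ((1 - of_nat n) * coeff ?B k) * h ^ k \<le> ?m * ?G n"
    unfolding pnorm_mult mult.assoc using assms G Suc by (intro mult_mono) auto
  have 2: "pnorm (coeff (pCons 0 ?B) k) * h ^ k \<le> ?m * ?G n"
  proof (cases k)
    case (Suc l)
    have "h * (pnorm (coeff ?B l) * h ^ l) \<le> ?m * ?G n"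
      using assms G Suc.IH by (intro mult_mono) auto
    then show ?thesis by (simp add: Suc mult_ac)
  next
    case 0
    have "0 \<le> ?m * ?G n"
      using assms by (intro mult_nonneg_nonneg G) (simp add: le_max_iff_disj)
    then show ?thesis by (simp add: 0)
  qed
  have "pnorm (coeff ([:1 - of_nat n, 1:] * ?B) k) * h ^ k \<le> ?m * ?G n"
  proof -
    have "coeff ([:1 - of_nat n, 1:] * ?B) k = (1 - of_nat n) * coeff ?B k + coeff (pCons 0 ?B) k"
      by simp
    then have "pnorm (coeff ([:1 - of_nat n, 1:] * ?B) k) * h ^ k \<le>
        max (pnorm ((1 - of_nat n) * coeff ?B k)) (pnorm (coeff (pCons 0 ?B) k)) * h ^ k"
      using assms by (simp only:) (intro mult_right_mono pnorm_ultrametric zero_le_power)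
    also have "\<dots> \<le> ?m * ?G n"
      using 1 2 by (rule max_mult_le)
    finally show ?thesis .
  qed
  then have "pnorm (coeff ([:1 - of_nat n, 1:] * ?B) k) * h ^ k / pnorm (of_nat (Suc n) :: 'a)
      \<le> ?m * ?G n / pnorm (of_nat (Suc n) :: 'a)"
    by (intro divide_right_mono) auto
  moreover have "?m * ?G n / pnorm (of_nat (Suc n) :: 'a) = ?G (Suc n)"
    by (simp add: pnorm_mult mult_ac)
  ultimately show ?case
    by (simp add: pnorm_divide del: of_nat_Suc fact_Suc mult_pCons_left pCons_0_0)
qed

text \<open>If the norm of \<open>h\<close> is no integral power of \<open>p\<close>, then the ultrametric
  inequality is an equality for \<open>h - m\<close>.\<close>

lemma exists_generic_element:
  assumes "l < r" "0 < r"
  obtains h :: 'a where "l \<le> pnorm h" "pnorm h < r" "h \<noteq> 0"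
    "\<And>m. pnorm (h - of_int m) = max (pnorm h) (pnorm (of_int m :: 'a))"
proof -
  \<comment> \<open>A positive lower bound even if \<open>l \<le> 0\<close>, so that its logarithm
    is meaningful.\<close>
  define l' where "l' = max l (r / 2)"
  have l': "0 < l'" "l \<le> l'" "l' < r" using assms by (auto simp: l'_def)
  define a b where "a = log p l'" and "b = log p r"
  have p1: "1 < real p" using p_gt_1 by simp
  have "a < b" unfolding a_def b_def using l' p1 by (intro log_less) auto
  obtain t where t: "t \<in> \<rat>" "t \<notin> \<int>" "a < t" "t < b"
  proof -
    obtain t where t: "t \<in> \<rat>" "a < t" "t < b"
      using \<open>a < b\<close> Rats_dense_in_real by blast
    show ?thesis
    proof (cases "t \<in> \<int>")
      case True
      \<comment> \<open>Strictly between an integer and its successor there is no integer.\<close>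
      obtain t' where t': "t' \<in> \<rat>" "t < t'" "t' < min b (t + 1)"
        using Rats_dense_in_real[of t "min b (t + 1)"] t by auto
      have "t' \<notin> \<int>"
      proof
        assume "t' \<in> \<int>"
        with True obtain m n where "t = of_int m" "t' = of_int n" by (auto elim!: Ints_cases)
        with t' show False by simp
      qed
      then show ?thesis using t t' that[of t'] by auto
    qed (use t that in blast)
  qed
  obtain i j where ij: "j > 0" "t = of_int i / of_int j"
    using t(1) by (auto elim: Rats_cases')
  \<comment> \<open>A root of a power of p realises the norm p^t; the sign of i is reversed because
    p itself has norm 1/p.\<close>
  obtain h :: 'a where h: "h ^ nat j = of_nat p powi (- i)"
    using nth_root_exists[of "nat j"] ij by auto
  have nh: "pnorm h = real p powr t"
  proof (rule power_eq_imp_eq_base)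
    show "pnorm h ^ nat j = (real p powr t) ^ nat j"
      using h ij p1 by (simp add: pnorm_p_powi powr_power powr_real_of_int flip: pnorm_power)
        (simp add: power_int_def powr_real_of_int power_inverse)
    show "0 < nat j" using ij by simp
  qed auto
  have neq: "pnorm h \<noteq> pnorm (of_int m :: 'a)" for m
  proof (cases "m = 0")
    case False
    then obtain k where "pnorm (of_int m :: 'a) = (1 / real p) ^ k"
      by (rule pnorm_of_int_cases)
    also have "\<dots> = real p powr (- real k)"
      using p1 by (simp add: powr_minus powr_realpow power_one_over inverse_eq_divide)
    finally show ?thesis
      using t(2) p1 unfolding nh by (auto simp: powr_inj)
  qed (use p1 nh in auto)
  show ?thesis
  proof (rule that)
    have "l' = real p powr a" "r = real p powr b"
      using l' assms p1 by (auto simp: a_def b_def)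
    then have "l' < pnorm h" "pnorm h < r"
      using t p1 by (auto simp: nh)
    then show "l \<le> pnorm h" "pnorm h < r" using l' by auto
    show "h \<noteq> 0" using \<open>l' < pnorm h\<close> l' by auto
    show "pnorm (h - of_int m) = max (pnorm h) (pnorm (of_int m :: 'a))" for m
      using pnorm_add_eq[of h "- of_int m"] pnorm_add_eq[of "- of_int m" h] neq[of m]
      by (cases "pnorm h < pnorm (of_int m :: 'a)") auto
  qed
qed

text \<open>Convergence at s controls only the values of the binomial polynomials at s, whereas the
  rearrangement needs a bound for each of their coefficients. The hypothesis is therefore made on
  the whole ball: it is applied at a generic point \<open>1 + h\<close> with h at least as large as
  \<open>s - 1\<close>, where value and Gauss norm agree. The sequence v will hold powers of
  \<open>unit_part p \<iota> (x + a) - 1\<close>, integrated over a.\<close>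

lemma power_series_on_gbinomial_suminf:
  fixes v :: "nat \<Rightarrow> 'a"
  assumes v: "\<And>n. pnorm (v n) \<le> C * \<rho> ^ n" and \<rho>: "0 \<le> \<rho>"
    and null: "\<And>s. s \<in> ball 1 r \<Longrightarrow> binom_null (s :: 'a) \<rho>"
  shows "power_series_on (ball 1 r) 1 (\<lambda>s. \<Sum>n. (s gchoose n) * v n)"
proof -
  define b where "b k = (\<Sum>n. coeff (shifted_binom_poly n) k * v n)" for k
  have "(\<lambda>k. b k * (s - 1) ^ k) sums (\<Sum>n. (s gchoose n) * v n)" if "s \<in> ball 1 r" for s
  proof -
    have s: "pnorm (s - 1) < r" "0 < r"
      using that order.strict_trans1[OF zero_le_dist[of 1 s], of r]
      by (auto simp: dist_eq_pnorm pnorm_minus_commute)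
    then obtain h :: 'a where h: "pnorm (s - 1) \<le> pnorm h" "pnorm h < r"
      "\<And>m. pnorm (h - of_int m) = max (pnorm h) (pnorm (of_int m :: 'a))"
      using exists_generic_element by metis
    have null': "binom_null (1 + h) \<rho>"
      using h by (intro null) (simp add: dist_eq_pnorm)
    have norm_h: "pnorm (1 + h gchoose n) =
        (\<Prod>i<n. max (pnorm h) (pnorm (1 - of_nat i :: 'a))) / pnorm (fact n :: 'a)" for n
    proof -
      have "pnorm (1 + h - of_nat i) = max (pnorm h) (pnorm (1 - of_nat i :: 'a))" for i
        using h(3)[of "int i - 1"] pnorm_minus_commute[of 1 "of_nat i"] by (simp add: algebra_simps)
      then show ?thesis by (simp add: pnorm_gbinomial)
    qed
    have C: "0 \<le> C" using order.trans[OF pnorm_nonneg v[of 0]] by simp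
    define a where "a n k = (s - 1) ^ k * (coeff (shifted_binom_poly n) k * v n)" for n k
    have bound: "pnorm (a n k) \<le> C * (pnorm (1 + h gchoose n) * \<rho> ^ n)" for n k
    proof -
      have "pnorm (a n k) = pnorm (coeff (shifted_binom_poly n) k :: 'a) * pnorm (s - 1) ^ k * pnorm (v n)"
        by (simp add: a_def pnorm_mult pnorm_power)
      also have "\<dots> \<le> pnorm (coeff (shifted_binom_poly n) k :: 'a) * pnorm h ^ k * (C * \<rho> ^ n)"
        using h v \<rho> C by (intro mult_mono power_mono) auto
      also have "\<dots> \<le> pnorm (1 + h gchoose n) * (C * \<rho> ^ n)"
        using pnorm_coeff_shifted_binom_poly[of "pnorm h" n k] \<rho> C norm_h[of n]
        by (intro mult_right_mono) auto
      finally show ?thesis by (simp add: mult_ac)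
    qed
    have tend: "(\<lambda>n. C * (pnorm (1 + h gchoose n) * \<rho> ^ n)) \<longlonglongrightarrow> 0"
      using null' unfolding binom_null_def by (rule tendsto_mult_right_zero)
    have zero: "a n k = 0" if "n < k" for n k
      using that degree_shifted_binom_poly[of n, where 'a = 'a] by (simp add: a_def coeff_eq_0)
    have row: "(\<Sum>k\<le>n. a n k) = (s gchoose n) * v n" for n
    proof -
      have "(\<Sum>k\<le>n. coeff (shifted_binom_poly n) k * (s - 1) ^ k) = poly (shifted_binom_poly n) (s - 1)"
        unfolding poly_altdef using degree_shifted_binom_poly[of n, where 'a = 'a]
        by (intro sum.mono_neutral_right) (auto simp: coeff_eq_0)
      moreover have "(\<Sum>k\<le>n. a n k) = (\<Sum>k\<le>n. coeff (shifted_binom_poly n) k * (s - 1) ^ k) * v n"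
        unfolding a_def sum_distrib_right by (intro sum.cong) auto
      ultimately show ?thesis
        by (simp add: poly_shifted_binom_poly)
    qed
    have "summable (\<lambda>n. a n k)" for k
      by (rule triangular_interchange(1)[of a, OF bound tend zero])
    then have "(\<Sum>n. a n k) = b k * (s - 1) ^ k" for k
      unfolding a_def b_def by (subst suminf_mult_pnorm) auto
    moreover have "(\<lambda>k. \<Sum>n. a n k) sums (\<Sum>n. \<Sum>k\<le>n. a n k)"
      by (rule triangular_interchange(2)[of a, OF bound tend zero])
    ultimately show ?thesis
      by (simp add: row)
  qed
  then show ?thesis
    unfolding power_series_on_def by blast
qed

end

section \<open>Value group and residue field\<close>

context padic_complex
begin

lemma padic_algebraic_approx:
  assumes "e > 0"
  obtains z :: 'a where "padic_algebraic z" "pnorm (z - w) < e"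
  using algebraic_dense assms closure_approachable[of w "{z :: 'a. padic_algebraic z}"]
  by (auto simp: dist_eq_pnorm)

text \<open>The principle behind Newton polygons: a term of strictly largest norm cannot be
  cancelled by the others.\<close>

lemma zero_sum_max_twice:
  fixes f :: "'b \<Rightarrow> 'a"
  assumes "finite A" "i0 \<in> A" "f i0 \<noteq> 0" "sum f A = 0"
    and max: "\<And>i. i \<in> A \<Longrightarrow> pnorm (f i) \<le> pnorm (f i0)"
  obtains i where "i \<in> A" "i \<noteq> i0" "pnorm (f i) = pnorm (f i0)"
proof -
  have "\<exists>i\<in>A. i \<noteq> i0 \<and> pnorm (f i) = pnorm (f i0)"
  proof (rule ccontr)
    assume "\<not> ?thesis"
    then have "pnorm (sum f (A - {i0})) < pnorm (f i0)"
      using max assms by (intro pnorm_sum_less) (auto simp: less_le)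
    moreover have "f i0 = - sum f (A - {i0})"
      using assms by (simp add: sum_diff1 eq_neg_iff_add_eq_0)
    ultimately show False by simp
  qed
  then show ?thesis using that by blast
qed

text \<open>In a polynomial equation for a nearby algebraic z two terms of largest norm have equal
  norm. Their coefficients have norms in the powers of p, so the quotient of the two powers of z
  does too.\<close>

lemma pnorm_rational_power:
  assumes "x \<noteq> (0 :: 'a)"
  obtains i :: int and j :: nat where "j > 0" "pnorm x ^ j = real p powi i"
proof -
  obtain z where z: "padic_algebraic z" "pnorm (z - x) < pnorm x"
    using padic_algebraic_approx[of "pnorm x" x] assms by auto
  have zx: "pnorm z = pnorm x" using z(2) by (rule pnorm_eq_of_diff_less)
  then have z0: "z \<noteq> 0" using assms by auto
  obtain f where f: "f \<noteq> 0" "\<And>i. coeff f i \<in> padic_nums" "poly f z = 0"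
    using z(1) unfolding padic_algebraic_def by blast
  let ?t = "\<lambda>i. coeff f i * z ^ i"
  \<comment> \<open>Only nonzero terms are kept, since it is their coefficients whose norms are
    known to be integral powers of p.\<close>
  let ?A = "{i. i \<le> degree f \<and> ?t i \<noteq> 0}"
  have "?t (degree f) \<noteq> 0"
    by (intro no_zero_divisors power_not_zero leading_coeff_neq_0 f(1) z0)
  then have d: "degree f \<in> ?A" by (intro CollectI conjI order.refl)
  have fin: "finite ?A" by simp
  have "finite ((\<lambda>i. pnorm (?t i)) ` ?A)" "(\<lambda>i. pnorm (?t i)) ` ?A \<noteq> {}"
    using d by (simp, blast)
  from Max_in[OF this] obtain i0 where i0: "i0 \<in> ?A" "pnorm (?t i0) = Max ((\<lambda>i. pnorm (?t i)) ` ?A)"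
    by (metis (no_types, lifting) imageE)
  have "sum ?t ?A = (\<Sum>i\<le>degree f. ?t i)"
    by (rule sum.mono_neutral_left) auto
  then have s: "sum ?t ?A = 0" using f(3) by (simp add: poly_altdef)
  obtain i1 where i1: "i1 \<in> ?A" "i1 \<noteq> i0" "pnorm (?t i1) = pnorm (?t i0)"
    using zero_sum_max_twice[OF fin i0(1) _ s] i0 fin by auto
  have *: "\<exists>j>0. \<exists>i. pnorm x ^ j = real p powi i"
    if kl: "k < l" "k \<in> ?A" "l \<in> ?A" "pnorm (?t k) = pnorm (?t l)" for k l
  proof -
    obtain u where u: "pnorm (coeff f k) = real p powi u"
      using padic_nums_pnorm_cases[OF f(2), of k] kl(2) by auto
    obtain v where v: "pnorm (coeff f l) = real p powi v"
      using padic_nums_pnorm_cases[OF f(2), of l] kl(3) by auto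
    have "real p powi u * pnorm x ^ k = real p powi v * pnorm x ^ l"
      using kl(4) by (simp add: pnorm_mult pnorm_power u v zx)
    also have "pnorm x ^ l = pnorm x ^ (l - k) * pnorm x ^ k"
      using kl(1) by (simp flip: power_add)
    finally have "real p powi u = real p powi v * pnorm x ^ (l - k)"
      using assms by simp
    then have "pnorm x ^ (l - k) = real p powi (u - v)"
      using p_gt_1 by (simp add: power_int_diff field_simps)
    then show ?thesis using kl(1) by (intro exI[of _ "l - k"]) auto
  qed
  show ?thesis
  proof (cases "i0 < i1")
    case True
    from *[OF this i0(1) i1(1) i1(3)[symmetric]] show ?thesis using that by blast
  next
    case False
    with i1(2) have "i1 < i0" by simp
    from *[OF this i1(1) i0(1) i1(3)] show ?thesis using that by blast
  qed
qed

section \<open>The residue field: units are roots of unity up to elements of norm below 1\<close>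

lemma rat_approx_int:
  assumes "y \<in> \<rat>" "pnorm (y :: 'a) \<le> 1"
  obtains m where "pnorm (y - of_int m) < 1"
proof -
  obtain a b where ab: "b > 0" "coprime a b" "y = of_int a / of_int b"
    using assms(1) by (auto elim: Rats_cases')
  \<comment> \<open>In lowest terms a factor p of the denominator would force norm above 1. The
    denominator can then be inverted modulo p.\<close>
  have b1: "\<not> int p dvd b"
  proof
    assume b: "int p dvd b"
    with ab(2) have "\<not> int p dvd a"
      using p_gt_1 coprime_common_divisor[of a b "int p"] by auto
    then have "pnorm (of_int a :: 'a) = 1" by (rule pnorm_of_int_coprime)
    moreover have "pnorm (of_int b :: 'a) < 1" using b by (rule pnorm_of_int_dvd_less)
    moreover have "pnorm (of_int b :: 'a) > 0" using ab(1) by simp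
    ultimately have "1 < pnorm y"
      by (simp add: ab(3) pnorm_divide)
    then show False using assms(2) by simp
  qed
  have nb: "pnorm (of_int b :: 'a) = 1" using b1 by (rule pnorm_of_int_coprime)
  have "coprime b (int p)"
    using b1 prime_imp_coprime[of "int p" b] prime_p by (simp add: coprime_commute)
  then obtain c d where cd: "c * b + d * int p = 1"
    using bezout_int[of b "int p"] by auto
  have "of_int (c * b + d * int p) = (1 :: 'a)" unfolding cd by simp
  then have "1 - of_int c * of_int b = (of_int d * of_nat p :: 'a)"
    by (simp add: algebra_simps)
  moreover have "y - of_int (a * c) = of_int a / of_int b * (1 - of_int c * of_int b)"
    using ab by (simp add: field_simps)
  ultimately have "y - of_int (a * c) = of_int a / of_int b * (of_int d * of_nat p)"
    by simp
  then have "pnorm (y - of_int (a * c)) = pnorm (of_int a :: 'a) * pnorm (of_int d :: 'a) / real p"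
    by (simp only: pnorm_mult pnorm_divide nb pnorm_p) simp
  also have "\<dots> \<le> 1 * 1 / real p"
    by (intro divide_right_mono mult_mono pnorm_of_int_le_1) auto
  also have "\<dots> < 1" using p_gt_1 by simp
  finally show ?thesis by (rule that)
qed

text \<open>The residue of z is algebraic over the field with p elements: an equation for z is
  normalised by a coefficient of largest norm, its coefficients are replaced by integers in the same
  residue class, and the leading one is made 1 by inverting it modulo p.\<close>

lemma unit_residue_monic_relation:
  assumes z: "padic_algebraic z" "pnorm (z :: 'a) = 1"
  obtains k and b :: "nat \<Rightarrow> int" where "pnorm (z ^ k + (\<Sum>i<k. of_int (b i) * z ^ i)) < 1"
proof -
  obtain f where f: "f \<noteq> 0" "\<And>i. coeff f i \<in> padic_nums" "poly f z = 0"
    using z(1) unfolding padic_algebraic_def by blast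
  let ?D = "degree f"
  let ?N = "(\<lambda>i. pnorm (coeff f i)) ` {..?D}"
  have "Max ?N \<in> ?N" by (intro Max_in) auto
  then obtain j where j: "j \<le> ?D" "pnorm (coeff f j) = Max ?N"
    by (metis (mono_tags, lifting) atMost_iff imageE)
  define B where "B = pnorm (coeff f j)"
  have B: "pnorm (coeff f i) \<le> B" if "i \<le> ?D" for i
    unfolding B_def j(2) using that by (intro Max_ge) auto
  have "0 < pnorm (coeff f ?D)" using f(1) by simp
  then have B0: "B > 0" using B[of ?D] by (rule order.strict_trans2) simp
  \<comment> \<open>Accuracy B turns into accuracy 1 after division by \<open>y j\<close>, whose
    norm is B.\<close>
  have "\<exists>y\<in>\<rat>. pnorm (coeff f i - y) < B" for i
    using padic_nums_approx[OF f(2) B0] by blast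
  then obtain y where y: "\<And>i. y i \<in> \<rat>" "\<And>i. pnorm (coeff f i - y i) < B"
    by metis
  have yj: "pnorm (y j) = B"
    using pnorm_eq_of_diff_less[of "y j" "coeff f j"] y(2)[of j]
    by (simp add: B_def pnorm_minus_commute)
  have yB: "pnorm (y i) \<le> B" if "i \<le> ?D" for i
    using pnorm_diff_le[of "coeff f i" "coeff f i - y i"] y(2)[of i] B[OF that] by simp
  have "\<exists>m. pnorm (y i / y j - of_int m) < 1" if "i \<le> ?D" for i
  proof -
    have "pnorm (y i / y j) \<le> 1"
      using yB[OF that] yj B0 by (simp add: pnorm_divide)
    then show ?thesis
      using rat_approx_int[of "y i / y j"] y(1) by (metis Rats_divide)
  qed
  then obtain m where m: "\<And>i. i \<le> ?D \<Longrightarrow> pnorm (y i / y j - of_int (m i)) < 1"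
    by metis
  have yj0: "y j \<noteq> 0" using yj B0 by auto
  have rel: "pnorm (\<Sum>i\<le>?D. of_int (m i) * z ^ i) < 1"
  proof -
    have "pnorm (\<Sum>i\<le>?D. (coeff f i / y j - of_int (m i)) * z ^ i) < 1"
    proof (rule pnorm_sum_less)
      fix i assume i: "i \<in> {..?D}"
      have "pnorm ((coeff f i - y i) / y j) < 1"
        using y(2)[of i] yj B0 by (simp add: pnorm_divide)
      then have "pnorm ((coeff f i - y i) / y j + (y i / y j - of_int (m i))) < 1"
        using pnorm_ultrametric[of "(coeff f i - y i) / y j" "y i / y j - of_int (m i)"] m[of i] i
        by simp
      then show "pnorm ((coeff f i / y j - of_int (m i)) * z ^ i) < 1"
        by (simp add: pnorm_mult pnorm_power z(2) diff_divide_distrib)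
    qed simp
    moreover have "(\<Sum>i\<le>?D. (coeff f i / y j - of_int (m i)) * z ^ i) =
        poly f z / y j - (\<Sum>i\<le>?D. of_int (m i) * z ^ i)"
      by (simp add: poly_altdef left_diff_distrib sum_subtractf sum_divide_distrib)
    ultimately show ?thesis by (simp add: f(3))
  qed
  let ?I = "{i. i \<le> ?D \<and> \<not> int p dvd m i}"
  have "j \<in> ?I"
  proof -
    have "pnorm (1 - of_int (m j) :: 'a) < 1" using m[OF j(1)] yj0 by simp
    then have "pnorm (of_int (m j) :: 'a) = 1"
      using pnorm_eq_of_diff_less[of "of_int (m j)" "1 :: 'a"] by (simp add: pnorm_minus_commute)
    then have "\<not> pnorm (of_int (m j) :: 'a) \<le> (1 / real p) ^ 1"
      using p_gt_1 by simp
    then show ?thesis using j(1) pnorm_of_int_le_iff[of "m j" 1] by simp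
  qed
  then have I: "finite ?I" "?I \<noteq> {}" by auto
  \<comment> \<open>The degree of the equation modulo p. The reduction is not zero because
    \<open>m j\<close> is congruent to 1.\<close>
  define k where "k = Max ?I"
  have k: "k \<le> ?D" "\<not> int p dvd m k" using Max_in[OF I] by (auto simp: k_def)
  have above: "int p dvd m i" if "k < i" "i \<le> ?D" for i
  proof (rule ccontr)
    assume "\<not> int p dvd m i"
    with that have "i \<in> ?I" by blast
    from Max_ge[OF I(1) this] that(1) show False unfolding k_def by linarith
  qed
  have "pnorm (\<Sum>i\<le>k. of_int (m i) * z ^ i) < 1"
  proof -
    have "{..?D} = {..k} \<union> {k<..?D}" using k(1) by auto
    then have "(\<Sum>i\<le>?D. of_int (m i) * z ^ i) =
        (\<Sum>i\<le>k. of_int (m i) * z ^ i) + (\<Sum>i\<in>{k<..?D}. of_int (m i) * z ^ i)"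
      by (simp add: sum.union_disjoint ivl_disj_int)
    moreover have "pnorm (\<Sum>i\<in>{k<..?D}. of_int (m i) * z ^ i) < 1"
      by (intro pnorm_sum_less) (auto simp: pnorm_mult pnorm_power z(2) intro: pnorm_of_int_dvd_less above)
    ultimately show ?thesis
      using pnorm_diff_le[of "\<Sum>i\<le>?D. of_int (m i) * z ^ i" "\<Sum>i\<in>{k<..?D}. of_int (m i) * z ^ i"] rel
      by simp
  qed
  then have rel': "pnorm (of_int (m k) * z ^ k + (\<Sum>i<k. of_int (m i) * z ^ i)) < 1"
    by (simp add: lessThan_Suc_atMost[symmetric] add.commute)
  have "coprime (m k) (int p)"
    using k(2) prime_imp_coprime[of "int p" "m k"] prime_p by (simp add: coprime_commute)
  then obtain c d where cd: "c * m k + d * int p = 1"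
    using bezout_int[of "m k" "int p"] by auto
  have 1: "z ^ k + (\<Sum>i<k. of_int (c * m i) * z ^ i) =
      of_int c * (of_int (m k) * z ^ k + (\<Sum>i<k. of_int (m i) * z ^ i)) + of_int (d * int p) * z ^ k"
  proof -
    have "of_int (c * m k + d * int p) = (1 :: 'a)" unfolding cd by simp
    then have "z ^ k = (of_int c * of_int (m k) + of_int (d * int p)) * z ^ k"
      by simp
    then show ?thesis
      by (simp add: sum_distrib_left algebra_simps)
  qed
  have "pnorm (of_int c * (of_int (m k) * z ^ k + (\<Sum>i<k. of_int (m i) * z ^ i))) < 1"
    using mult_right_mono[OF pnorm_of_int_le_1[of c] pnorm_nonneg] rel'
    by (simp add: pnorm_mult) (metis mult_1 order.strict_trans1)
  moreover have "pnorm (of_int (d * int p) * z ^ k) < 1"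
    using pnorm_of_int_dvd_less[of "d * int p"] by (simp add: pnorm_mult pnorm_power z(2))
  ultimately have "pnorm (z ^ k + (\<Sum>i<k. of_int (c * m i) * z ^ i)) < 1"
    unfolding 1 by (intro order.strict_trans1[OF pnorm_ultrametric]) simp
  then show ?thesis by (rule that)
qed

text \<open>Modulo elements of norm below 1, the powers of z stay in the span of the first k of them
  over the integers. For \<open>k = 0\<close> the relation would say that 1 has norm below
  1.\<close>

lemma power_near_residue_combination:
  assumes z: "pnorm (z :: 'a) = 1"
    and rel: "pnorm (z ^ k + (\<Sum>i<k. of_int (b i) * z ^ i)) < 1"
  shows "\<exists>a :: nat \<Rightarrow> int. pnorm (z ^ n - (\<Sum>i<k. of_int (a i) * z ^ i)) < 1"
proof (cases k)
  case 0
  with rel show ?thesis by simp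
next
  case (Suc l)
  show ?thesis
  proof (induction n)
    case 0
    have "(\<Sum>i<k. of_int (if i = 0 then 1 else 0) * z ^ i) = 1"
      unfolding Suc by (subst sum.lessThan_Suc_shift) simp
    then show ?case by (intro exI[of _ "\<lambda>i. if i = 0 then 1 else 0"]) simp
  next
    case (Suc n)
    then obtain a :: "nat \<Rightarrow> int" where a: "pnorm (z ^ n - (\<Sum>i<k. of_int (a i) * z ^ i)) < 1"
      by blast
    \<comment> \<open>Multiplication by z shifts the coefficients; the overflow
      \<open>a l * z ^ k\<close> is removed with the monic relation.\<close>
    define a' where "a' i = (if i = 0 then 0 else a (i - 1)) - a l * b i" for i
    have "(\<Sum>i<k. of_int (if i = 0 then 0 else a (i - 1)) * z ^ i) = z * (\<Sum>i<l. of_int (a i) * z ^ i)"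
      unfolding \<open>k = Suc l\<close> by (subst sum.lessThan_Suc_shift) (simp add: sum_distrib_left mult_ac)
    moreover have "(\<Sum>i<k. of_int (a' i) * z ^ i) =
        (\<Sum>i<k. of_int (if i = 0 then 0 else a (i - 1)) * z ^ i - of_int (a l) * (of_int (b i) * z ^ i))"
      by (intro sum.cong) (auto simp: a'_def algebra_simps)
    ultimately have "(\<Sum>i<k. of_int (a' i) * z ^ i) =
        z * (\<Sum>i<l. of_int (a i) * z ^ i) - of_int (a l) * (\<Sum>i<k. of_int (b i) * z ^ i)"
      by (simp only: sum_subtractf sum_distrib_left[symmetric])
    moreover have "(\<Sum>i<k. of_int (a i) * z ^ i) = (\<Sum>i<l. of_int (a i) * z ^ i) + of_int (a l) * z ^ l"
      unfolding \<open>k = Suc l\<close> by simp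
    ultimately have eq: "z ^ Suc n - (\<Sum>i<k. of_int (a' i) * z ^ i) =
        z * (z ^ n - (\<Sum>i<k. of_int (a i) * z ^ i)) +
        of_int (a l) * (z ^ k + (\<Sum>i<k. of_int (b i) * z ^ i))"
      by (simp add: \<open>k = Suc l\<close> algebra_simps)
    have "pnorm (z * (z ^ n - (\<Sum>i<k. of_int (a i) * z ^ i))) < 1"
      using a by (simp add: pnorm_mult z)
    moreover have "pnorm (of_int (a l) * (z ^ k + (\<Sum>i<k. of_int (b i) * z ^ i))) < 1"
      unfolding pnorm_mult
      using mult_right_mono[OF pnorm_of_int_le_1[of "a l"] pnorm_nonneg] rel
      by (metis mult_1 order.strict_trans1)
    ultimately show ?case
      unfolding eq[symmetric]
      by (intro exI[of _ a']) (simp only: eq, intro order.strict_trans1[OF pnorm_ultrametric], simp)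
  qed
qed

text \<open>Pigeonhole: modulo p there are finitely many coefficient vectors, so two powers of z
  have the same residue and their quotient is close to 1.\<close>

lemma exists_power_near_one:
  assumes "pnorm (w :: 'a) = 1"
  obtains m where "m > 0" "pnorm (w ^ m - 1) < 1"
proof -
  obtain z where z: "padic_algebraic z" "pnorm (z - w) < 1"
    using padic_algebraic_approx[of 1 w] by auto
  have z1: "pnorm z = 1" using pnorm_eq_of_diff_less[of z w] z(2) assms by simp
  obtain k and b :: "nat \<Rightarrow> int" where "pnorm (z ^ k + (\<Sum>i<k. of_int (b i) * z ^ i)) < 1"
    using unit_residue_monic_relation[OF z(1) z1] by blast
  from power_near_residue_combination[OF z1 this]
  obtain a :: "nat \<Rightarrow> nat \<Rightarrow> int" where a: "\<And>n. pnorm (z ^ n - (\<Sum>i<k. of_int (a n i) * z ^ i)) < 1"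
    by metis
  \<comment> \<open>Restricting to the first k indices puts the reduced vectors into a finite
    function space.\<close>
  define g where "g n = restrict (\<lambda>i. a n i mod int p) {..<k}" for n
  have "range g \<subseteq> PiE {..<k} (\<lambda>_. {0..<int p})"
    using p_gt_1 by (auto simp: g_def split: if_splits)
  then have "finite (range g)"
    by (rule finite_subset) (auto intro!: finite_PiE)
  then have "\<not> inj g"
    using finite_imageD infinite_UNIV_nat by blast
  then obtain i j where ij: "i < j" "g i = g j"
    by (metis injI linorder_neqE_nat)
  have dvd: "int p dvd a j l - a i l" if "l < k" for l
    using fun_cong[OF ij(2), of l] that by (simp add: g_def mod_eq_dvd_iff dvd_diff_commute)
  have "pnorm ((\<Sum>l<k. of_int (a j l) * z ^ l) - (\<Sum>l<k. of_int (a i l) * z ^ l)) < 1"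
  proof -
    have "pnorm (\<Sum>l<k. of_int (a j l - a i l) * z ^ l) < 1"
    proof (rule pnorm_sum_less)
      fix l assume "l \<in> {..<k}"
      then have "pnorm (of_int (a j l - a i l) :: 'a) < 1"
        using dvd by (intro pnorm_of_int_dvd_less) auto
      then show "pnorm (of_int (a j l - a i l) * z ^ l) < 1"
        by (simp add: pnorm_mult pnorm_power z1 del: of_int_diff)
    qed simp
    then show ?thesis
      by (simp add: left_diff_distrib sum_subtractf)
  qed
  from pnorm_diff_trans[OF a[of j] this] a[of i] have ji: "pnorm (z ^ j - z ^ i) < 1"
    using pnorm_diff_trans pnorm_minus_commute by metis
  define m where "m = j - i"
  have "z ^ j - z ^ i = z ^ i * (z ^ m - 1)"
    using ij(1) by (simp add: m_def right_diff_distrib flip: power_add)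
  with ji have zm: "pnorm (z ^ m - 1) < 1"
    by (simp add: pnorm_mult pnorm_power z1)
  \<comment> \<open>The pigeonhole argument concerns the algebraic z; equal residues of w and z
    carry over to their powers.\<close>
  have "pnorm (w ^ m - z ^ m) < 1"
  proof -
    have "w ^ m - z ^ m = (w - z) * (\<Sum>i<m. z ^ (m - Suc i) * w ^ i)"
      by (simp add: power_diff_sumr2)
    moreover have "pnorm (\<Sum>i<m. z ^ (m - Suc i) * w ^ i) \<le> 1"
      by (intro pnorm_sum_le) (auto simp: pnorm_mult pnorm_power z1 assms)
    ultimately show ?thesis
      using z(2) mult_mono[of "pnorm (w - z)" "pnorm (w - z)" "pnorm (\<Sum>i<m. z ^ (m - Suc i) * w ^ i)" 1]
      by (simp add: pnorm_mult pnorm_minus_commute)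
  qed
  then have "pnorm ((w ^ m - z ^ m) + (z ^ m - 1)) < 1"
    using zm by (intro order.strict_trans1[OF pnorm_ultrametric]) simp
  then show ?thesis
    using ij(1) by (intro that[of m]) (auto simp: m_def)
qed

text \<open>Frobenius is injective on residues: with \<open>t = y - 1\<close>, the inner binomial
  coefficients are divisible by p, so \<open>y ^ p - 1\<close> and \<open>t ^ p\<close> differ by an
  element of norm below 1.\<close>

lemma near_one_of_prime_power:
  assumes "pnorm (y ^ p - 1 :: 'a) < 1"
  shows "pnorm (y - 1) < 1"
proof -
  have "pnorm (y ^ p) = 1" using pnorm_eq_of_diff_less[of "y ^ p" 1] assms by simp
  then have "pnorm y ^ p = 1" by (simp add: pnorm_power)
  then have y: "pnorm y = 1"
    using p_gt_1 power_eq_imp_eq_base[of "pnorm y" p 1] by simp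
  define t where "t = y - 1"
  have t: "pnorm t \<le> 1" unfolding t_def using pnorm_diff_le[of y 1] y by simp
  have "y ^ p = (\<Sum>i\<le>p. of_nat (p choose i) * t ^ i)"
    using binomial_ring[of t 1 p] by (simp add: t_def)
  also have "{..p} = insert 0 (insert p {0<..<p})" using p_gt_1 by auto
  finally have yp: "y ^ p = 1 + (t ^ p + (\<Sum>i\<in>{0<..<p}. of_nat (p choose i) * t ^ i))"
    using p_gt_1 by simp
  have "pnorm (\<Sum>i\<in>{0<..<p}. of_nat (p choose i) * t ^ i) < 1"
  proof (rule pnorm_sum_less)
    fix i assume i: "i \<in> {0<..<p}"
    then have "p dvd p choose i" using prime_p by (intro dvd_choose_prime) auto
    then have "pnorm (of_int (int (p choose i)) :: 'a) \<le> (1 / real p) ^ 1"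
      by (subst pnorm_of_int_le_iff) simp
    moreover have "pnorm t ^ i \<le> 1" using t by (simp add: power_le_one)
    ultimately have "pnorm (of_nat (p choose i) * t ^ i) \<le> 1 / real p * 1"
      unfolding pnorm_mult pnorm_power by (intro mult_mono) auto
    also have "\<dots> < 1" using p_gt_1 by simp
    finally show "pnorm (of_nat (p choose i) * t ^ i) < 1" .
  qed simp
  moreover have "t ^ p = (y ^ p - 1) - (\<Sum>i\<in>{0<..<p}. of_nat (p choose i) * t ^ i)"
    using yp by simp
  ultimately have "pnorm (t ^ p) < 1"
    using assms by (simp only:) (intro order.strict_trans1[OF pnorm_diff_le], simp)
  then show ?thesis
    unfolding t_def[symmetric] pnorm_power using t
    by (metis less_le power_one less_irrefl)
qed

text \<open>The least exponent works: a factor p could be removed by injectivity of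
  Frobenius.\<close>

lemma exists_coprime_power_near_one:
  assumes "pnorm (w :: 'a) = 1"
  obtains m where "m > 0" "coprime m p" "pnorm (w ^ m - 1) < 1"
proof -
  define m where "m = (LEAST m. m > 0 \<and> pnorm (w ^ m - 1) < 1)"
  have m: "m > 0 \<and> pnorm (w ^ m - 1) < 1"
    unfolding m_def by (rule LeastI_ex) (use exists_power_near_one[OF assms] in blast)
  have "\<not> p dvd m"
  proof
    assume "p dvd m"
    then obtain l where l: "m = l * p" by (metis dvd_def mult.commute)
    then have "pnorm ((w ^ l) ^ p - 1) < 1" using m by (simp add: power_mult)
    then have "pnorm (w ^ l - 1) < 1" by (rule near_one_of_prime_power)
    moreover have "l > 0" "l < m" using l m p_gt_1 by auto
    ultimately show False
      using not_less_Least[of l "\<lambda>m. m > 0 \<and> pnorm (w ^ m - 1) < 1"] by (simp add: m_def)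
  qed
  then have "coprime m p"
    using prime_p prime_imp_coprime coprime_commute by blast
  then show ?thesis using m that by blast
qed

text \<open>Algebraic closedness replaces Hensel's lemma: \<open>w ^ m - 1\<close> is the product of
  the differences of w to the m-th roots of unity, and if all had norm at least 1, so would the
  product.\<close>

lemma exists_root_of_unity_near:
  assumes "m > 0" "pnorm (w ^ m - 1 :: 'a) < 1"
  obtains \<zeta> where "\<zeta> ^ m = 1" "pnorm (w - \<zeta>) < 1"
proof -
  define f :: "'a poly" where "f = monom 1 m - 1"
  have lc: "coeff f m = 1" using assms(1) by (simp add: f_def)
  have "degree f \<le> m" unfolding f_def by (intro degree_diff_le) (auto simp: degree_monom_eq)
  moreover have "degree f \<ge> m" using lc by (intro le_degree) simp
  ultimately have "degree f = m" by simp
  with lc have lead: "lead_coeff f = 1" by simp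
  then have "f \<noteq> 0" by auto
  then obtain A where A: "f = (\<Prod>x\<in>#A. [:-x, 1:])"
    using alg_closed_imp_factorization[of f] lead by auto
  have ge: "1 \<le> pnorm (\<Prod>x\<in>#B. w - x)" if "\<forall>x\<in>#B. 1 \<le> pnorm (w - x)" for B
    using that
  proof (induction B)
    case (add x B)
    then show ?case using mult_mono[of 1 "pnorm (w - x)" 1 "pnorm (\<Prod>x\<in>#B. w - x)"]
      by (simp add: pnorm_mult)
  qed simp
  have "poly f w = (\<Prod>x\<in>#A. w - x)"
    unfolding A by (simp add: poly_prod_mset image_mset.compositionality comp_def)
  moreover have "poly f w = w ^ m - 1" by (simp add: f_def poly_monom)
  ultimately obtain \<zeta> where \<zeta>: "\<zeta> \<in># A" "pnorm (w - \<zeta>) < 1"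
    using ge[of A] assms(2) by force
  have "poly f \<zeta> = 0"
    unfolding A using \<zeta>(1) by (auto simp: poly_prod_mset prod_mset_zero_iff)
  then have "\<zeta> ^ m = 1" by (simp add: f_def poly_monom)
  then show ?thesis using \<zeta>(2) by (rule that)
qed

text \<open>The cofactor of \<open>y - 1\<close> in \<open>y ^ k - 1\<close> is a sum of k elements
  close to 1, hence close to k, which is a unit. This gives the uniqueness of the root of unity in
  the decomposition and later transfers distances to 1 from a power to its base.\<close>

lemma pnorm_power_minus_one:
  assumes "pnorm (y - 1 :: 'a) < 1" "\<not> p dvd k"
  shows "pnorm (y ^ k - 1) = pnorm (y - 1)"
proof -
  have y: "pnorm y = 1" using pnorm_eq_of_diff_less[of y 1] assms by simp
  have s: "pnorm (\<Sum>i<n. y ^ i) \<le> 1" for n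
    by (intro pnorm_sum_le) (auto simp: pnorm_power y)
  have "pnorm (y ^ n - 1) < 1" for n
    unfolding power_diff_1_eq[of y] pnorm_mult
    using mult_mono[OF order.refl s[of n], of "pnorm (y - 1)"] assms(1) by simp
  then have "pnorm (\<Sum>i<k. y ^ i - 1) < 1"
    by (intro pnorm_sum_less) auto
  then have "pnorm ((\<Sum>i<k. y ^ i) - of_nat k) < pnorm (of_nat k :: 'a)"
    using pnorm_of_nat_coprime[OF assms(2)] by (simp add: sum_subtractf)
  then have "pnorm (\<Sum>i<k. y ^ i) = 1"
    using pnorm_eq_of_diff_less pnorm_of_nat_coprime[OF assms(2)] by metis
  then show ?thesis
    by (simp add: power_diff_1_eq pnorm_mult)
qed

lemma near_roots_of_unity_eq:
  assumes "\<zeta> ^ m = (1 :: 'a)" "coprime m p" "\<xi> ^ n = 1" "coprime n p" "pnorm (\<zeta> - \<xi>) < 1"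
    and "pnorm \<xi> = 1"
  shows "\<zeta> = \<xi>"
proof -
  have \<xi>0: "\<xi> \<noteq> 0" using assms(6) by auto
  have "pnorm (\<zeta> / \<xi> - 1) < 1"
    using assms(5,6) \<xi>0 pnorm_divide[of "\<zeta> - \<xi>" \<xi>] by (simp add: diff_divide_distrib)
  moreover have "coprime (m * n) p" using assms by simp
  then have "\<not> p dvd m * n" using p_gt_1 by (metis coprime_common_divisor dvd_refl less_irrefl nat_dvd_1_iff_1)
  ultimately have "pnorm ((\<zeta> / \<xi>) ^ (m * n) - 1) = pnorm (\<zeta> / \<xi> - 1)"
    by (rule pnorm_power_minus_one)
  moreover have "(\<zeta> / \<xi>) ^ (m * n) = 1"
  proof -
    have "\<zeta> ^ (m * n) = 1" using assms(1) by (simp add: power_mult)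
    moreover have "\<xi> ^ (m * n) = 1" using assms(3) by (subst mult.commute) (simp add: power_mult)
    ultimately show ?thesis by (simp add: power_divide)
  qed
  ultimately show ?thesis using \<xi>0 by simp
qed

end

section \<open>Volkenborn integral and the measures\<close>

context padic_complex
begin

text \<open>Successive means differ by at most p in norm: shifting b by a multiple of
  \<open>p ^ N\<close> changes its power by a multiple of \<open>p ^ N\<close>, and the mean divides
  by \<open>p ^ Suc N\<close>. Ultrametrically these differences do not accumulate.\<close>

lemma pnorm_vmean_monomial_le: "pnorm (vmean p N (\<lambda>a :: 'a. a ^ j)) \<le> real p"
proof (induction N)
  case 0
  have "pnorm ((0 :: 'a) ^ j) \<le> 1" by (cases j) auto
  then show ?case using p_gt_1 by (simp add: vmean_def)
next
  case (Suc N)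
  let ?q = "p ^ N"
  let ?f = "\<lambda>a. of_nat a ^ j :: 'a"
  let ?S = "\<Sum>a<?q. ?f a"
  \<comment> \<open>The range is cut into p blocks of length \<open>p ^ N\<close>, so that the old
    sum can be subtracted from each.\<close>
  have "(\<Sum>a<p ^ Suc N. ?f a) = (\<Sum>m<p. sum ?f {m * ?q..<m * ?q + ?q})"
    by (simp add: sum.nat_group mult.commute)
  also have "\<dots> = (\<Sum>m<p. \<Sum>b<?q. ?f (b + m * ?q))"
    using sum.shift_bounds_nat_ivl[of ?f 0 "_ * ?q" ?q]
    by (simp add: atLeast0LessThan add.commute)
  finally have S: "(\<Sum>a<p ^ Suc N. ?f a) - of_nat p * ?S = (\<Sum>m<p. \<Sum>b<?q. ?f (b + m * ?q) - ?f b)"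
    by (simp add: sum_subtractf)
  have "pnorm (?f (b + m * ?q) - ?f b) \<le> (1 / real p) ^ N" for b m
  proof -
    have "?f (b + m * ?q) - ?f b = of_nat p ^ N *
        (of_nat m * (\<Sum>i<j. of_nat b ^ (j - Suc i) * of_nat (b + m * ?q) ^ i))"
      unfolding power_diff_sumr2 by simp
    also have "\<dots> = of_nat p ^ N * of_nat (m * (\<Sum>i<j. b ^ (j - Suc i) * (b + m * ?q) ^ i))"
      by simp
    finally have "pnorm (?f (b + m * ?q) - ?f b) = (1 / real p) ^ N *
        pnorm (of_nat (m * (\<Sum>i<j. b ^ (j - Suc i) * (b + m * ?q) ^ i)) :: 'a)"
      by (simp only: pnorm_mult[of "of_nat p ^ N"] pnorm_power pnorm_p)
    also have "\<dots> \<le> (1 / real p) ^ N * 1"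
      by (intro mult_left_mono pnorm_of_nat_le_1) auto
    finally show ?thesis by simp
  qed
  then have "pnorm ((\<Sum>a<p ^ Suc N. ?f a) - of_nat p * ?S) \<le> (1 / real p) ^ N"
    unfolding S by (intro pnorm_sum_le) auto
  moreover have "vmean p (Suc N) (\<lambda>a. a ^ j) - vmean p N (\<lambda>a. a ^ j) =
      ((\<Sum>a<p ^ Suc N. ?f a) - of_nat p * ?S) / of_nat p ^ Suc N"
    using p_gt_1 by (simp add: vmean_def diff_divide_distrib)
  ultimately have "pnorm (vmean p (Suc N) (\<lambda>a. a ^ j) - vmean p N (\<lambda>a :: 'a. a ^ j)) \<le>
      (1 / real p) ^ N / (1 / real p) ^ Suc N"
    by (simp only: pnorm_divide[of _ "of_nat p ^ Suc N"] pnorm_power pnorm_p) (intro divide_right_mono, auto)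
  also have "\<dots> = real p" using p_gt_1 by simp
  finally have "pnorm (vmean p (Suc N) (\<lambda>a. a ^ j) - vmean p N (\<lambda>a :: 'a. a ^ j)) \<le> real p" .
  then show ?case
    using pnorm_ultrametric[of "vmean p (Suc N) (\<lambda>a. a ^ j) - vmean p N (\<lambda>a :: 'a. a ^ j)"
        "vmean p N (\<lambda>a. a ^ j)"] Suc
    by simp
qed

text \<open>After division by \<open>p ^ N\<close> the power sum formula is a polynomial in
  \<open>p ^ N\<close> with constant term \<open>bernoulli j\<close>.\<close>

lemma vmean_monomial_tendsto: "(\<lambda>N. vmean p N (\<lambda>a :: 'a. a ^ j)) \<longlonglongrightarrow> bernoulli j"
proof -
  define c where "c i = fact j * (bernoulli i / fact i) / (fact (j + 1 - i) :: 'a)" for i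
  have eq: "vmean p N (\<lambda>a :: 'a. a ^ j) = (\<Sum>i\<le>j. c i * (of_nat p ^ N) ^ (j - i))" for N
  proof -
    have "vmean p N (\<lambda>a :: 'a. a ^ j) = (\<Sum>i\<le>j. c i * ((of_nat p ^ N) ^ (j + 1 - i) / of_nat p ^ N))"
      unfolding vmean_def power_sum_bernoulli c_def sum_divide_distrib by simp
    also have "\<dots> = (\<Sum>i\<le>j. c i * (of_nat p ^ N) ^ (j - i))"
      using p_gt_1 by (intro sum.cong) (auto simp: Suc_diff_le)
    finally show ?thesis .
  qed
  have "(\<lambda>N. (of_nat p ^ N) ^ (j - i) :: 'a) \<longlonglongrightarrow> (if i = j then 1 else 0)" if "i \<le> j" for i
  proof (cases "i = j")
    case False
    have "(\<lambda>N. ((1 / real p) ^ (j - i)) ^ N) \<longlonglongrightarrow> 0"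
      using False that p_gt_1 by (intro LIMSEQ_power_zero) (auto simp: power_less_one_iff abs_if power_strict_mono field_simps)
    then show ?thesis
      using False
      by (subst tendsto_iff_pnorm) (simp add: pnorm_power pnorm_p mult.commute flip: power_mult)
  qed auto
  then have "(\<lambda>N. \<Sum>i\<le>j. c i * (of_nat p ^ N) ^ (j - i)) \<longlonglongrightarrow> (\<Sum>i\<le>j. c i * (if i = j then 1 else 0))"
    by (intro tendsto_sum_pnorm tendsto_mult_left_pnorm) auto
  also have "(\<Sum>i\<le>j. c i * (if i = j then 1 else 0)) = (\<Sum>i\<in>{j}. c i * (if i = j then 1 else 0))"
    by (rule sum.mono_neutral_right) auto
  also have "\<dots> = c j" by simp
  also have "c j = bernoulli j" by (simp add: c_def)
  finally show ?thesis by (simp add: eq)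
qed

lemma vmean_affine_power:
  "vmean p N (\<lambda>a. (\<alpha> + \<beta> * a) ^ n :: 'a) =
    (\<Sum>i\<le>n. of_nat (n choose i) * \<beta> ^ i * \<alpha> ^ (n - i) * vmean p N (\<lambda>a. a ^ i))"
proof -
  have "(\<alpha> + \<beta> * a) ^ n = (\<Sum>i\<le>n. of_nat (n choose i) * \<beta> ^ i * \<alpha> ^ (n - i) * a ^ i)" for a
    unfolding add.commute[of \<alpha>] binomial_ring by (intro sum.cong) (auto simp: power_mult_distrib)
  then have "vmean p N (\<lambda>a. (\<alpha> + \<beta> * a) ^ n) =
      (\<Sum>a<p ^ N. \<Sum>i\<le>n. of_nat (n choose i) * \<beta> ^ i * \<alpha> ^ (n - i) * of_nat a ^ i) / of_nat p ^ N"
    by (simp add: vmean_def)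
  also have "\<dots> = (\<Sum>i\<le>n. of_nat (n choose i) * \<beta> ^ i * \<alpha> ^ (n - i) * vmean p N (\<lambda>a. a ^ i))"
    by (subst sum.swap) (simp add: vmean_def sum_divide_distrib sum_distrib_left)
  finally show ?thesis .
qed

lemma pnorm_affine_term_le:
  assumes "pnorm (\<alpha> :: 'a) \<le> \<rho>" "pnorm \<beta> \<le> \<rho>" "i \<le> n" "pnorm m \<le> real p"
  shows "pnorm (of_nat (n choose i) * \<beta> ^ i * \<alpha> ^ (n - i) * m) \<le> real p * \<rho> ^ n"
proof -
  have \<rho>: "0 \<le> \<rho>" using order.trans[OF pnorm_nonneg assms(1)] .
  have "pnorm (of_nat (n choose i) * \<beta> ^ i * \<alpha> ^ (n - i) * m) \<le> 1 * \<rho> ^ i * \<rho> ^ (n - i) * real p"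
    unfolding pnorm_mult pnorm_power using \<rho>
    by (intro mult_mono power_mono assms pnorm_of_nat_le_1 mult_nonneg_nonneg zero_le_power pnorm_nonneg) auto
  also have "\<dots> = real p * \<rho> ^ n"
    using assms(3) by (simp flip: power_add)
  finally show ?thesis .
qed

text \<open>A weak form of the von Staudt-Clausen theorem, inherited from the uniform bound on the
  means.\<close>

lemma pnorm_bernoulli_le: "pnorm (bernoulli j :: 'a) \<le> real p"
proof (rule ccontr)
  assume *: "\<not> pnorm (bernoulli j :: 'a) \<le> real p"
  then have "0 < pnorm (bernoulli j :: 'a)" by (meson not_le of_nat_0_le_iff order.strict_trans1)
  then have "\<forall>\<^sub>F N in sequentially. pnorm (vmean p N (\<lambda>a :: 'a. a ^ j) - bernoulli j) < pnorm (bernoulli j :: 'a)"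
    using vmean_monomial_tendsto[of j] unfolding tendsto_iff_eventually_pnorm by blast
  then obtain N where "pnorm (vmean p N (\<lambda>a :: 'a. a ^ j) - bernoulli j) < pnorm (bernoulli j :: 'a)"
    by (auto simp: eventually_sequentially)
  then show False
    using pnorm_eq_of_diff_less pnorm_vmean_monomial_le[of N j] * by metis
qed

lemma pnorm_affine_moment_le:
  assumes "pnorm (\<alpha> :: 'a) \<le> \<rho>" "pnorm \<beta> \<le> \<rho>"
  shows "pnorm (affine_moment \<alpha> \<beta> n) \<le> real p * \<rho> ^ n"
proof -
  have \<rho>: "0 \<le> \<rho>" using order.trans[OF pnorm_nonneg assms(1)] .
  then show ?thesis
    unfolding affine_moment_def
    by (intro pnorm_sum_le pnorm_affine_term_le assms pnorm_bernoulli_le) auto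
qed

text \<open>The series is assumed at natural numbers only, the points that Volkenborn sums sample.
  Affine arguments serve two purposes: \<alpha> = 0 gives the expansion in powers of 1/x, and
  general \<alpha> the expansion in powers of
  \<open>unit_part p \<iota> (x + a) - 1\<close>.\<close>

lemma
  fixes f :: "'a \<Rightarrow> 'a"
  assumes f: "\<And>a. (\<lambda>n. c n * (\<alpha> + \<beta> * of_nat a) ^ n) sums f (of_nat a)"
    and \<alpha>: "pnorm \<alpha> \<le> \<rho>" and \<beta>: "pnorm \<beta> \<le> \<rho>"
    and c: "(\<lambda>n. pnorm (c n) * \<rho> ^ n) \<longlonglongrightarrow> 0"
  shows summable_affine_moments: "summable (\<lambda>n. c n * affine_moment \<alpha> \<beta> n)"
    and volkenborn_affine_series: "volkenborn p f = (\<Sum>n. c n * affine_moment \<alpha> \<beta> n)"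
proof -
  define t where "t N n = c n * vmean p N (\<lambda>a. (\<alpha> + \<beta> * a) ^ n)" for N n
  have \<rho>: "0 \<le> \<rho>" using order.trans[OF pnorm_nonneg \<alpha>] .
  have "pnorm (vmean p N (\<lambda>a. (\<alpha> + \<beta> * a) ^ n)) \<le> real p * \<rho> ^ n" for N n
    unfolding vmean_affine_power using \<rho>
    by (intro pnorm_sum_le pnorm_affine_term_le \<alpha> \<beta> pnorm_vmean_monomial_le) auto
  then have bound: "pnorm (t N n) \<le> real p * (pnorm (c n) * \<rho> ^ n)" for N n
    unfolding t_def pnorm_mult mult.left_commute[of "real p"]
    by (rule mult_left_mono) simp
  have tend: "(\<lambda>n. real p * (pnorm (c n) * \<rho> ^ n)) \<longlonglongrightarrow> 0"
    using c by (rule tendsto_mult_right_zero)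
  have lim: "(\<lambda>N. t N n) \<longlonglongrightarrow> c n * affine_moment \<alpha> \<beta> n" for n
    unfolding t_def affine_moment_def vmean_affine_power
    by (intro tendsto_mult_left_pnorm tendsto_sum_pnorm vmean_monomial_tendsto)
  show "summable (\<lambda>n. c n * affine_moment \<alpha> \<beta> n)"
    by (rule tannery_pnorm(1)[OF bound tend lim])
  have "(\<Sum>n. t N n) = (\<Sum>a<p ^ N. f (of_nat a)) / of_nat p ^ N" for N
  proof -
    have "(\<lambda>n. inverse (of_nat p ^ N) * (\<Sum>a<p ^ N. c n * (\<alpha> + \<beta> * of_nat a) ^ n)) sums
        (inverse (of_nat p ^ N) * (\<Sum>a<p ^ N. f (of_nat a)))"
      by (intro sums_mult_pnorm sums_sum_pnorm f)
    then show ?thesis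
      by (simp add: sums_iff t_def vmean_def divide_inverse sum_distrib_left mult_ac)
  qed
  moreover have "(\<lambda>N. \<Sum>n. t N n) \<longlonglongrightarrow> (\<Sum>n. c n * affine_moment \<alpha> \<beta> n)"
    by (rule tannery_pnorm(2)[OF bound tend lim])
  ultimately show "volkenborn p f = (\<Sum>n. c n * affine_moment \<alpha> \<beta> n)"
    unfolding volkenborn_def by (intro limI) simp
qed

lemma affine_moment_zero: "affine_moment 0 \<beta> n = \<beta> ^ n * bernoulli n"
proof -
  have "affine_moment 0 \<beta> n = (\<Sum>i\<in>{n}. of_nat (n choose i) * \<beta> ^ i * 0 ^ (n - i) * bernoulli i)"
    unfolding affine_moment_def by (rule sum.mono_neutral_right) auto
  then show ?thesis by simp
qed

section \<open>Integration against the measures \<open>mu p n\<close>\<close>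

lemma of_nat_in_padic_coset_iff:
  assumes "a < p ^ N" "d < p ^ N"
  shows "of_nat d \<in> (padic_coset p N a :: 'a set) \<longleftrightarrow> d = a"
proof
  assume "of_nat d \<in> (padic_coset p N a :: 'a set)"
  then obtain z :: 'a where z: "z \<in> padic_ints" "of_nat d = of_nat a + of_nat p ^ N * z"
    unfolding padic_coset_def by auto
  have "(of_int (int d - int a) :: 'a) = of_nat p ^ N * z"
    using z(2) by simp
  then have "pnorm (of_int (int d - int a) :: 'a) = (1 / real p) ^ N * pnorm z"
    by (simp only: pnorm_mult pnorm_power pnorm_p)
  also have "\<dots> \<le> (1 / real p) ^ N * 1"
    using padic_ints_pnorm_le[OF z(1)] by (intro mult_left_mono) auto
  finally have "int p ^ N dvd int d - int a"
    by (simp add: pnorm_of_int_le_iff[of "int d - int a"] flip: of_int_diff)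
  moreover have "\<bar>int d - int a\<bar> < int p ^ N"
    using assms by (simp add: abs_less_iff flip: of_nat_power)
  ultimately show "d = a"
    using zdvd_not_zless[of "\<bar>int d - int a\<bar>" "int p ^ N"] by auto
next
  assume "d = a"
  then show "of_nat d \<in> (padic_coset p N a :: 'a set)"
    using of_int_in_padic_ints[of 0] unfolding padic_coset_def by (intro image_eqI[of _ _ 0]) auto
qed

text \<open>The Riemann sums are constant once \<open>n < p ^ N\<close>: every divisor of n is then
  the chosen representative of its own coset.\<close>

lemma padic_integral_mu:
  fixes f :: "'a \<Rightarrow> 'a"
  assumes "n > 0"
  shows "padic_integral p (mu p n) f = (\<Sum>d | d dvd n \<and> \<not> p dvd d. inverse (of_nat d) * f (of_nat d))"
    (is "_ = ?R")
proof -
  have "(\<Sum>a<p ^ N. f (of_nat a) * mu p n (padic_coset p N a)) = ?R" if "N \<ge> n" for N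
  proof -
    have "n < p ^ n" using p_gt_1 by (simp add: power_gt_expt)
    also have "p ^ n \<le> p ^ N" using that p_gt_1 by (intro power_increasing) auto
    finally have nN: "n < p ^ N" .
    let ?A = "{d. d dvd n \<and> \<not> p dvd d}"
    have dN: "d < p ^ N" if "d \<in> ?A" for d
      using dvd_imp_le[of d n] that assms nN by auto
    have "(\<Sum>a<p ^ N. f (of_nat a) * mu p n (padic_coset p N a)) =
        (\<Sum>a<p ^ N. \<Sum>d\<in>?A. f (of_nat a) * (inverse (of_nat d) * dirac (of_nat d) (padic_coset p N a :: 'a set)))"
      by (simp add: mu_def sum_distrib_left)
    also have "\<dots> = (\<Sum>d\<in>?A. \<Sum>a<p ^ N. if a = d then inverse (of_nat d) * f (of_nat d) else 0)"
      by (subst sum.swap, intro sum.cong) (auto simp: dirac_def of_nat_in_padic_coset_iff dN)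
    also have "\<dots> = ?R"
      using dN by (intro sum.cong) auto
    finally show ?thesis .
  qed
  then have "(\<lambda>N. \<Sum>a<p ^ N. f (of_nat a) * mu p n (padic_coset p N a)) \<longlonglongrightarrow> ?R"
    by (intro tendsto_eventually eventually_sequentiallyI)
  then show ?thesis
    unfolding padic_integral_def by (rule limI)
qed

end

section \<open>Teichmueller decomposition\<close>

locale padic_complex_embedding = padic_complex p ty + Qbar_embedding \<iota>
  for p and ty :: "'a::{field_char_0, alg_closed_field, complete_space} itself"
    and \<iota> :: "complex \<Rightarrow> 'a"
begin

lemma embedding_zero: "\<iota> 0 = 0"
  using add[of 0 0] by simp

lemma embedding_of_nat: "\<iota> (of_nat n) = of_nat n"
  by (induction n) (auto simp: embedding_zero one add)

lemma embedding_inverse_of_nat: "n > 0 \<Longrightarrow> \<iota> (inverse (of_nat n)) = inverse (of_nat n)"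
  using mult[of "of_nat n" "inverse (of_nat n)"]
  by (simp add: algebraic_inverse one embedding_of_nat inverse_unique)

lemma embedding_powi: "\<iota> (of_nat p powi i) = of_nat p powi i"
proof (cases "i \<ge> 0")
  case True
  then show ?thesis
    using embedding_of_nat[of "p ^ nat i"] by (simp add: power_int_def)
next
  case False
  then show ?thesis
    using embedding_inverse_of_nat[of "p ^ nat (- i)"] p_gt_1
    by (simp add: power_int_def power_inverse)
qed

lemma algebraic_of_power:
  assumes "algebraic (y ^ n :: complex)" "n > 0"
  shows "algebraic y"
  by (rule algebraic_root[OF assms(1), of "monom 1 n"])
    (use assms(2) in \<open>auto simp: poly_monom coeff_monom degree_monom_eq\<close>)

lemma algebraic_powi_of_nat: "algebraic (of_nat p powi i :: complex)"
  by (cases "i \<ge> 0") (auto simp: power_int_def power_inverse simp flip: of_nat_power)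

text \<open>This relation is enough to compute the norm of the image, and to see that a suitable
  power of it lies in a given extension of the p-adic numbers.\<close>

lemma ppow_power:
  assumes "(x :: 'a) \<noteq> 0" "j > 0" "pnorm x ^ j = real p powi i"
  shows "ppow p \<iota> (vp p x) ^ j = of_nat p powi (- i)"
proof -
  define r where "r = real p powr vp p x"
  have p1: "1 < real p" using p_gt_1 by simp
  have "r = 1 / pnorm x"
    using assms(1) p1 powr_log_cancel[of "real p" "pnorm x"]
    by (simp add: r_def vp_def powr_minus inverse_eq_divide)
  then have rj: "r ^ j = real p powi (- i)"
    using assms(3) by (simp add: power_one_over power_int_minus inverse_eq_divide power_divide)
  define c where "c = complex_of_real r"
  have cj: "c ^ j = of_nat p powi (- i)"
    unfolding c_def using rj by (simp flip: of_real_power)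
  \<comment> \<open>The embedding is multiplicative on algebraic numbers only, so the relation
    passes through it one algebraic power of c at a time.\<close>
  have alg: "algebraic (c ^ n)" for n
  proof (rule algebraic_of_power)
    have "(c ^ n) ^ j = of_nat p powi (- i * int n)"
      using cj by (metis power_commutes power_mult mult.commute power_int_mult power_int_of_nat)
    then show "algebraic ((c ^ n) ^ j)" by (simp only: algebraic_powi_of_nat)
  qed (rule assms(2))
  have "\<iota> (c ^ n) = \<iota> c ^ n" for n
    by (induction n) (use alg alg[of 1] in \<open>auto simp: one mult\<close>)
  then have "\<iota> c ^ j = of_nat p powi (- i)"
    using cj embedding_powi by metis
  then show ?thesis by (simp add: ppow_def c_def r_def)
qed

lemma pnorm_ppow:
  assumes "(x :: 'a) \<noteq> 0"
  shows "pnorm (ppow p \<iota> (vp p x)) = pnorm x"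
proof -
  obtain i j where ij: "j > 0" "pnorm x ^ j = real p powi i"
    using pnorm_rational_power[OF assms] by blast
  have "pnorm (ppow p \<iota> (vp p x)) ^ j = pnorm x ^ j"
    using ppow_power[OF assms ij] ij by (simp add: pnorm_p_powi flip: pnorm_power)
  then show ?thesis
    by (rule power_eq_imp_eq_base) (simp_all add: ij(1))
qed

lemma teich_ex1:
  assumes "(x :: 'a) \<noteq> 0"
  shows "\<exists>!z. (\<exists>m>0. coprime m p \<and> z ^ m = 1) \<and> pnorm (x / ppow p \<iota> (vp p x) - z) < 1"
proof (rule ex_ex1I)
  let ?w = "x / ppow p \<iota> (vp p x)"
  have w: "pnorm ?w = 1" using assms by (simp add: pnorm_divide pnorm_ppow)
  obtain m where m: "m > 0" "coprime m p" "pnorm (?w ^ m - 1) < 1"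
    using exists_coprime_power_near_one[OF w] by blast
  show "\<exists>z. (\<exists>m>0. coprime m p \<and> z ^ m = 1) \<and> pnorm (?w - z) < 1"
    using exists_root_of_unity_near[OF m(1,3)] m by metis
  fix z z'
  assume z: "(\<exists>m>0. coprime m p \<and> z ^ m = 1) \<and> pnorm (?w - z) < 1"
    and z': "(\<exists>m>0. coprime m p \<and> z' ^ m = 1) \<and> pnorm (?w - z') < 1"
  have "pnorm z' = 1"
    using pnorm_eq_of_diff_less[of z' ?w] z' w by (simp add: pnorm_minus_commute)
  moreover have "pnorm (z - z') \<le> max (pnorm (?w - z')) (pnorm (?w - z))"
    using pnorm_diff_le[of "?w - z'" "?w - z"] by simp
  then have "pnorm (z - z') < 1"
    using z z' by linarith
  ultimately show "z = z'"
    using near_roots_of_unity_eq z z' by blast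
qed

lemma
  assumes "(x :: 'a) \<noteq> 0"
  shows teich_root_of_unity: "\<exists>m>0. coprime m p \<and> teich p \<iota> x ^ m = 1"
    and teich_near: "pnorm (x / ppow p \<iota> (vp p x) - teich p \<iota> x) < 1"
  using theI'[OF teich_ex1[OF assms]] unfolding teich_def by blast+

lemma pnorm_teich:
  assumes "(x :: 'a) \<noteq> 0"
  shows "pnorm (teich p \<iota> x) = 1"
proof -
  have "pnorm (x / ppow p \<iota> (vp p x)) = 1"
    using assms by (simp add: pnorm_divide pnorm_ppow)
  then show ?thesis
    using pnorm_eq_of_diff_less[of "teich p \<iota> x" "x / ppow p \<iota> (vp p x)"] teich_near[OF assms]
    by (simp add: pnorm_minus_commute)
qed

lemma pnorm_unit_part_minus_one:
  assumes "(x :: 'a) \<noteq> 0"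
  shows "pnorm (unit_part p \<iota> x - 1) < 1"
proof -
  have "teich p \<iota> x \<noteq> 0" using pnorm_teich[OF assms] by auto
  then have "unit_part p \<iota> x - 1 = (x / ppow p \<iota> (vp p x) - teich p \<iota> x) / teich p \<iota> x"
    by (simp add: unit_part_def diff_divide_distrib)
  then show ?thesis
    using teich_near[OF assms] pnorm_teich[OF assms] by (simp add: pnorm_divide)
qed

lemma unit_part_nonzero:
  assumes "(x :: 'a) \<noteq> 0"
  shows "unit_part p \<iota> x \<noteq> 0"
  using pnorm_unit_part_minus_one[OF assms] by auto

text \<open>The smaller summand changes neither the valuation nor, after division by the power of p,
  the residue. So \<open>ppow\<close> and \<open>teich\<close> agree for x and \<open>x + a\<close>,
  and the unit part scales like its argument.\<close>

lemma
  assumes x: "(x :: 'a) \<noteq> 0" and a: "pnorm a < pnorm x"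
  shows unit_part_add: "unit_part p \<iota> (x + a) = unit_part p \<iota> x * (1 + a / x)"
    and omega_v_add: "omega_v p \<iota> (x + a) = omega_v p \<iota> x"
proof -
  let ?P = "ppow p \<iota> (vp p x)"
  have P: "pnorm ?P = pnorm x" using x by (rule pnorm_ppow)
  then have P0: "?P \<noteq> 0" using x by auto
  have vp: "vp p (x + a) = vp p x"
    using pnorm_add_eq(2)[OF a] by (simp add: vp_def)
  have "pnorm (a / ?P) < 1" using a P x by (simp add: pnorm_divide)
  then have "pnorm ((x + a) / ?P - z) < 1 \<longleftrightarrow> pnorm (x / ?P - z) < 1" for z
    using pnorm_ultrametric[of "x / ?P - z" "a / ?P"] pnorm_diff_le[of "(x + a) / ?P - z" "a / ?P"]
    by (auto simp: add_divide_distrib algebra_simps)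
  then have teich: "teich p \<iota> (x + a) = teich p \<iota> x"
    by (simp add: teich_def vp)
  show u: "unit_part p \<iota> (x + a) = unit_part p \<iota> x * (1 + a / x)"
  proof -
    have "x + a = x * (1 + a / x)" using x by (simp add: distrib_left)
    then have "(x + a) / ?P / teich p \<iota> x = x / ?P / teich p \<iota> x * (1 + a / x)" by simp
    then show ?thesis by (simp only: unit_part_def teich vp)
  qed
  have "x + a \<noteq> 0" using a by (metis add_eq_0_iff less_irrefl pnorm_minus)
  then show "omega_v p \<iota> (x + a) = omega_v p \<iota> x"
    using x by (simp add: omega_v_def unit_part_def teich vp)
qed

lemma omega_v_mult_unit_part:
  assumes "(x :: 'a) \<noteq> 0"
  shows "omega_v p \<iota> x * unit_part p \<iota> x = x"
  using unit_part_nonzero[OF assms] by (simp add: omega_v_def)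

end

section \<open>The expansion\<close>

context padic_complex_embedding
begin

definition radius :: "'a \<Rightarrow> real"
  where "radius x = max (pnorm (unit_part p \<iota> x - 1)) (1 / pnorm x)"

lemma radius_bounds:
  assumes "pnorm x > 1"
  shows "0 < radius x" "radius x < 1"
proof -
  have x0: "x \<noteq> 0" using assms nonzero_of_pnorm_gt_1 by blast
  then have "0 < 1 / pnorm x" by simp
  then show "0 < radius x" unfolding radius_def by linarith
  show "radius x < 1"
    using assms x0 pnorm_unit_part_minus_one[OF x0] by (simp add: radius_def divide_less_eq_1)
qed

lemma pnorm_unit_part:
  assumes "x \<noteq> 0"
  shows "pnorm (unit_part p \<iota> x) = 1"
  using pnorm_eq_of_diff_less[of "unit_part p \<iota> x" 1] pnorm_unit_part_minus_one[OF assms] by simp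

lemma unit_part_add_minus_one:
  assumes "pnorm x > 1" "pnorm a \<le> 1"
  shows "unit_part p \<iota> (x + a) - 1 = (unit_part p \<iota> x - 1) + unit_part p \<iota> x / x * a"
proof -
  have "x \<noteq> 0" "pnorm a < pnorm x" using assms nonzero_of_pnorm_gt_1[of x] by auto
  from unit_part_add[OF this] show ?thesis by (simp add: algebra_simps)
qed

lemma pnorm_unit_part_div:
  assumes "x \<noteq> 0"
  shows "pnorm (unit_part p \<iota> x / x) = 1 / pnorm x"
  using pnorm_unit_part[OF assms] by (simp add: pnorm_divide)

lemma pnorm_unit_part_add_minus_one_le:
  assumes "pnorm x > 1" "pnorm a \<le> 1"
  shows "pnorm (unit_part p \<iota> (x + a) - 1) \<le> radius x"
proof -
  have "x \<noteq> 0" using assms nonzero_of_pnorm_gt_1 by blast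
  then have "pnorm (unit_part p \<iota> x / x * a) \<le> 1 / pnorm x * 1"
    unfolding pnorm_mult using assms pnorm_unit_part_div by (intro mult_mono) auto
  then show ?thesis
    unfolding unit_part_add_minus_one[OF assms] radius_def
    using pnorm_ultrametric[of "unit_part p \<iota> x - 1" "unit_part p \<iota> x / x * a"] by simp
qed

text \<open>The radius is attained at \<open>a = 0\<close> or at \<open>a = 1\<close>.\<close>

lemma G_domain_iff:
  assumes x: "pnorm x > 1"
  shows "s \<in> G_domain p \<iota> x \<longleftrightarrow> binom_null s (radius x)"
proof
  assume "binom_null s (radius x)"
  then show "s \<in> G_domain p \<iota> x"
    unfolding G_domain_def
    using padic_pow_sums pnorm_unit_part_add_minus_one_le[OF x] padic_ints_pnorm_le sums_summable
    by blast
next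
  assume s: "s \<in> G_domain p \<iota> x"
  have x0: "x \<noteq> 0" using x nonzero_of_pnorm_gt_1 by blast
  obtain a :: 'a where a: "a \<in> padic_ints" "pnorm (unit_part p \<iota> (x + a) - 1) = radius x"
  proof (cases "pnorm (unit_part p \<iota> x - 1) < 1 / pnorm x")
    case True
    have eq: "unit_part p \<iota> (x + 1) - 1 = (unit_part p \<iota> x - 1) + unit_part p \<iota> x / x"
      using unit_part_add_minus_one[OF x, of 1] by simp
    have "pnorm (unit_part p \<iota> (x + 1) - 1) = 1 / pnorm x"
      unfolding eq using True pnorm_unit_part_div[OF x0]
        pnorm_add_eq(1)[of "unit_part p \<iota> x - 1" "unit_part p \<iota> x / x"] by simp
    then show ?thesis
      using True of_int_in_padic_ints[of 1] by (intro that[of 1]) (auto simp: radius_def)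
  next
    case False
    then show ?thesis
      using of_int_in_padic_ints[of 0] by (intro that[of 0]) (auto simp: radius_def)
  qed
  have "summable (\<lambda>n. (s gchoose n) * (unit_part p \<iota> (x + a) - 1) ^ n)"
    using s a(1) unfolding G_domain_def by blast
  then show "binom_null s (radius x)"
    unfolding summable_pnorm_iff binom_null_def by (simp add: pnorm_mult pnorm_power a(2))
qed

lemma integrand_eq:
  assumes x: "pnorm x > 1" and a: "pnorm a \<le> 1" and s: "binom_null s (radius x)"
  shows "omega_v p \<iota> (x + a) * padic_pow (unit_part p \<iota> (x + a)) s =
    x * padic_pow (unit_part p \<iota> x) (s - 1) * padic_pow (1 + a / x) s"
proof -
  have x0: "x \<noteq> 0" and ax: "pnorm a < pnorm x" using x a nonzero_of_pnorm_gt_1[of x] by auto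
  let ?u = "unit_part p \<iota> x"
  note \<rho> = radius_bounds[OF x]
  have u: "pnorm (?u - 1) \<le> radius x" by (simp add: radius_def)
  have "pnorm (a / x) \<le> 1 / pnorm x" using a by (simp add: pnorm_divide divide_right_mono)
  then have ax': "pnorm (a / x) \<le> radius x" by (simp add: radius_def)
  have "padic_pow (unit_part p \<iota> (x + a)) s = padic_pow ((1 + (?u - 1)) * (1 + a / x)) s"
    using unit_part_add[OF x0 ax] by simp
  also have "\<dots> = padic_pow (1 + (?u - 1)) s * padic_pow (1 + a / x) s"
    by (rule padic_pow_mult[OF s \<rho> u ax'])
  \<comment> \<open>The split-off factor u combines with \<open>omega_v p \<iota> x\<close> to x,
    which explains the factor in front of the expansion.\<close>
  also have "padic_pow (1 + (?u - 1)) s = ?u * padic_pow ?u (s - 1)"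
    using padic_pow_step[OF s \<rho> u] by simp
  finally show ?thesis
    using omega_v_mult_unit_part[OF x0] omega_v_add[OF x0 ax] by (simp flip: mult.assoc)
qed

lemma binomial_series_div_sums:
  assumes x: "pnorm x > 1" and a: "pnorm a \<le> 1" and s: "binom_null s (radius x)"
  shows "(\<lambda>j. (s gchoose j) * (a / x) ^ j) sums padic_pow (1 + a / x) s"
proof (rule padic_pow_sums[OF s])
  have "pnorm (a / x) \<le> 1 / pnorm x" using a by (simp add: pnorm_divide divide_right_mono)
  then show "pnorm (a / x) \<le> radius x" by (simp add: radius_def)
qed

lemma G_coeff_pos:
  assumes "n > 0"
  shows "G_coeff p \<iota> s x n = (\<Sum>d | d dvd n \<and> \<not> p dvd d. inverse (of_nat d) *
    (omega_v p \<iota> (x + of_nat d) * padic_pow (unit_part p \<iota> (x + of_nat d)) s))"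
  using assms by (simp add: G_coeff_def padic_integral_mu)

text \<open>At \<open>1 - s\<close> the factor \<open>1 / ((1 - s) - 1)\<close> of the zeta function
  becomes \<open>- 1 / s\<close> and the exponent becomes s, so the constant coefficient integrates
  the same function as the others.\<close>

lemma G_coeff_zero:
  "G_coeff p \<iota> s x 0 = - (1 / (2 * s)) *
    volkenborn p (\<lambda>a. omega_v p \<iota> (x + a) * padic_pow (unit_part p \<iota> (x + a)) s)"
  by (simp add: G_coeff_def hurwitz_zeta_p_def mult.commute)

lemma binom_null_pnorm_mult:
  assumes "binom_null s \<rho>"
  shows "(\<lambda>n. pnorm (c * (s gchoose n) :: 'a) * \<rho> ^ n) \<longlonglongrightarrow> 0"
  using tendsto_mult_right_zero[of _ sequentially "pnorm c"] assms
  by (simp add: binom_null_def pnorm_mult mult.assoc)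

lemma G_star_expansion:
  assumes x: "pnorm x > 1" and s: "s \<in> G_domain p \<iota> x"
  shows "G_star_expansion p \<iota> s x"
proof -
  have null: "binom_null s (radius x)" using s G_domain_iff[OF x] by simp
  have x0: "x \<noteq> 0" using x nonzero_of_pnorm_gt_1 by blast
  define C where "C = x * padic_pow (unit_part p \<iota> x) (s - 1)"
  let ?D = "\<lambda>n. {d. d dvd n \<and> \<not> p dvd d}"
  let ?B = "\<lambda>j. (s gchoose j) * affine_moment 0 (1 / x) j"
  \<comment> \<open>At \<open>s = 0\<close> division by zero gives 0, so the constant coefficients
    vanish on both sides.\<close>
  define S where "S = Abs_fps (\<lambda>n. if n = 0 then - (1 / (2 * s)) * (\<Sum>j. ?B j)
    else \<Sum>d\<in>?D n. inverse (of_nat d) * padic_pow (1 + of_nat d / x) s)"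
  have volk: "summable ?B" "volkenborn p (\<lambda>a. omega_v p \<iota> (x + a) * padic_pow (unit_part p \<iota> (x + a)) s)
      = C * (\<Sum>j. ?B j)"
  proof -
    have f: "(\<lambda>n. C * (s gchoose n) * (0 + 1 / x * of_nat a) ^ n) sums
        (omega_v p \<iota> (x + of_nat a) * padic_pow (unit_part p \<iota> (x + of_nat a)) s)" for a
      using sums_mult_pnorm[OF binomial_series_div_sums[OF x pnorm_of_nat_le_1 null], of C a]
      by (simp add: integrand_eq[OF x pnorm_of_nat_le_1 null] C_def mult.assoc)
    have b: "pnorm (0 :: 'a) \<le> radius x" "pnorm (1 / x) \<le> radius x"
      using radius_bounds[OF x] by (auto simp: radius_def pnorm_divide)
    have f1: "(\<lambda>n. (s gchoose n) * (0 + 1 / x * of_nat a) ^ n) sums (padic_pow (1 + of_nat a / x) s)" for a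
      using binomial_series_div_sums[OF x pnorm_of_nat_le_1 null, of a] by simp
    have "(\<lambda>n. pnorm (s gchoose n) * radius x ^ n) \<longlonglongrightarrow> 0"
      using null by (simp add: binom_null_def)
    from summable_affine_moments[of "\<lambda>n. s gchoose n" 0 "1 / x" "\<lambda>a. padic_pow (1 + a / x) s", OF f1 b this]
    show sB: "summable ?B" .
    show "volkenborn p (\<lambda>a. omega_v p \<iota> (x + a) * padic_pow (unit_part p \<iota> (x + a)) s) = C * (\<Sum>j. ?B j)"
      using volkenborn_affine_series[of "\<lambda>n. C * (s gchoose n)", OF f b binom_null_pnorm_mult[OF null]]
        sums_mult_pnorm[OF summable_sums[OF sB], of C]
      by (simp add: sums_iff mult.assoc)
  qed
  show ?thesis
    unfolding G_star_expansion_def coeffwise_sums_def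
  proof (intro exI[of _ S] conjI allI)
    fix n
    have xj: "x powi (- int j) = (1 / x) ^ j" for j
      by (simp add: power_int_minus power_one_over inverse_eq_divide)
    show "(\<lambda>j. fps_nth (fps_const (s gchoose j) * e_series p j s * fps_const (x powi (- int j))) n) sums fps_nth S n"
    proof (cases "n = 0")
      case True
      have "(\<lambda>j. - (1 / (2 * s)) * ?B j) sums (- (1 / (2 * s)) * (\<Sum>j. ?B j))"
        by (intro sums_mult_pnorm summable_sums volk)
      moreover have "- (1 / (2 * s)) * ?B j = (s gchoose j) * (- bernoulli j / (2 * s)) * x powi (- int j)" for j
        by (simp add: affine_moment_zero xj mult_ac)
      ultimately have "(\<lambda>j. (s gchoose j) * (- bernoulli j / (2 * s)) * x powi (- int j)) sums
          (- (1 / (2 * s)) * (\<Sum>j. ?B j))"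
        by (simp only:)
      moreover have "fps_nth (fps_const (s gchoose j) * e_series p j s * fps_const (x powi (- int j))) n =
          (s gchoose j) * (- bernoulli j / (2 * s)) * x powi (- int j)" for j
        using True by (simp add: e_series_def)
      moreover have "fps_nth S n = - (1 / (2 * s)) * (\<Sum>j. ?B j)"
        using True by (simp add: S_def)
      ultimately show ?thesis by (simp only:)
    next
      case False
      have "(\<lambda>j. \<Sum>d\<in>?D n. inverse (of_nat d) * ((s gchoose j) * (of_nat d / x) ^ j)) sums
          (\<Sum>d\<in>?D n. inverse (of_nat d) * padic_pow (1 + of_nat d / x) s)"
        by (intro sums_sum_pnorm sums_mult_pnorm binomial_series_div_sums x pnorm_of_nat_le_1 null)
      moreover have "(\<Sum>d\<in>?D n. inverse (of_nat d) * ((s gchoose j) * (of_nat d / x) ^ j)) =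
          (s gchoose j) * sigma_star p j n * x powi (- int j)" for j
      proof -
        have "inverse (of_nat d) * ((s gchoose j) * (of_nat d / x) ^ j) =
            (s gchoose j) * of_nat d powi (int j - 1) * x powi (- int j)" if "d \<in> ?D n" for d
        proof -
          \<comment> \<open>Needed at \<open>j = 0\<close>, where the exponent is -1.\<close>
          have "d \<noteq> 0" using that False by auto
          then have "of_nat d powi (int j - 1) = (of_nat d ^ j * inverse (of_nat d) :: 'a)"
            by (simp add: power_int_diff field_simps)
          moreover have "(of_nat d / x) ^ j = of_nat d ^ j * (1 / x) ^ j"
            by (simp flip: power_mult_distrib)
          ultimately show ?thesis
            by (simp only: xj mult_ac)
        qed
        then show ?thesis
          unfolding sigma_star_def sum_distrib_left sum_distrib_right by (intro sum.cong) auto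
      qed
      ultimately show ?thesis
        using False by (simp add: S_def e_series_def)
    qed
  next
    show "G_star p \<iota> s x = fps_const (x * padic_pow (unit_part p \<iota> x) (s - 1)) * S"
    proof (rule fps_ext)
      fix n
      show "fps_nth (G_star p \<iota> s x) n =
          fps_nth (fps_const (x * padic_pow (unit_part p \<iota> x) (s - 1)) * S) n"
        unfolding C_def[symmetric]
        by (cases "n = 0")
          (simp_all add: G_star_def G_coeff_zero G_coeff_pos volk S_def sum_distrib_left
            integrand_eq[OF x pnorm_of_nat_le_1 null, folded C_def] mult_ac)
    qed
  qed
qed

section \<open>Analyticity of the coefficients in s\<close>

lemma pnorm_inverse_of_nat_coprime:
  assumes "\<not> p dvd d"
  shows "pnorm (inverse (of_nat d) :: 'a) = 1"
  using pnorm_of_nat_coprime[OF assms] by (simp add: pnorm_inverse)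

lemma power_series_on_cong:
  assumes "power_series_on D c f" "\<And>s. s \<in> D' \<Longrightarrow> s \<in> D \<and> f s = g s"
  shows "power_series_on D' c g"
  using assms unfolding power_series_on_def by metis

text \<open>The factor in front of the expansion depends on s. Instead of multiplying power series,
  the undivided integrand is expanded in powers of \<open>unit_part p \<iota> (x + a) - 1\<close>,
  so that each coefficient becomes a binomial series in s with weights v free of s.\<close>

lemma G_star_analytic:
  assumes x: "pnorm x > 1" and r: "ball 1 r \<subseteq> G_domain p \<iota> x"
  shows "G_star_analytic p \<iota> x r"
proof -
  have null: "binom_null s (radius x)" if "s \<in> ball 1 r" for s :: 'a
    using that r G_domain_iff[OF x] by blast
  have x0: "x \<noteq> 0" using x nonzero_of_pnorm_gt_1 by blast
  note \<rho> = radius_bounds[OF x]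
  let ?z = "\<lambda>a. unit_part p \<iota> (x + a) - 1"
  let ?w = "omega_v p \<iota> x"
  have w: "omega_v p \<iota> (x + of_nat d) = ?w" for d
    using omega_v_add[OF x0, of "of_nat d"] pnorm_of_nat_le_1[of d] x by simp
  have pw: "(\<lambda>n. (s gchoose n) * ?z (of_nat d) ^ n) sums padic_pow (unit_part p \<iota> (x + of_nat d)) s"
    if "s \<in> ball 1 r" for s :: 'a and d
    using padic_pow_sums[OF null[OF that] pnorm_unit_part_add_minus_one_le[OF x pnorm_of_nat_le_1, of d]]
    by simp
  show ?thesis
    unfolding G_star_analytic_def
  proof (intro conjI allI impI)
    fix n :: nat assume n: "1 \<le> n"
    let ?D = "{d. d dvd n \<and> \<not> p dvd d}"
    define v where "v k = (\<Sum>d\<in>?D. inverse (of_nat d) * (?w * ?z (of_nat d) ^ k))" for k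
    have "pnorm (v k) \<le> pnorm ?w * radius x ^ k" for k
      unfolding v_def
    proof (intro pnorm_sum_le)
      fix d assume "d \<in> ?D"
      then have "pnorm (inverse (of_nat d) * (?w * ?z (of_nat d) ^ k)) = pnorm ?w * pnorm (?z (of_nat d)) ^ k"
        by (simp add: pnorm_mult pnorm_power pnorm_inverse_of_nat_coprime)
      also have "\<dots> \<le> pnorm ?w * radius x ^ k"
        by (intro mult_left_mono power_mono pnorm_unit_part_add_minus_one_le x pnorm_of_nat_le_1) auto
      finally show "pnorm (inverse (of_nat d) * (?w * ?z (of_nat d) ^ k)) \<le> pnorm ?w * radius x ^ k" .
    qed (use \<rho> in simp)
    then have "power_series_on (ball 1 r) 1 (\<lambda>s. \<Sum>k. (s gchoose k) * v k)"
      using \<rho> null by (intro power_series_on_gbinomial_suminf[where \<rho> = "radius x"]) auto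
    then show "power_series_on (ball 1 r) 1 (\<lambda>s. fps_nth (G_star p \<iota> s x) n)"
    proof (rule power_series_on_cong, intro conjI)
      fix s :: 'a assume s: "s \<in> ball 1 r"
      have "(\<lambda>k. \<Sum>d\<in>?D. inverse (of_nat d) * ?w * ((s gchoose k) * ?z (of_nat d) ^ k)) sums
          (\<Sum>d\<in>?D. inverse (of_nat d) * ?w * padic_pow (unit_part p \<iota> (x + of_nat d)) s)"
        by (intro sums_sum_pnorm sums_mult_pnorm pw s)
      moreover have "(\<Sum>d\<in>?D. inverse (of_nat d) * ?w * ((s gchoose k) * ?z (of_nat d) ^ k)) =
          (s gchoose k) * v k" for k
        unfolding v_def sum_distrib_left by (intro sum.cong) auto
      ultimately show "(\<Sum>k. (s gchoose k) * v k) = fps_nth (G_star p \<iota> s x) n"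
        using n by (simp add: G_star_def G_coeff_pos w sums_iff mult.assoc)
    qed
  next
    let ?u = "unit_part p \<iota> x"
    \<comment> \<open>Multiplication by s has cancelled the pole and left -1/2. The affine function
      \<open>(?u - 1) + ?u / x * a\<close> is
      \<open>unit_part p \<iota> (x + a) - 1\<close>.\<close>
    define v where "v k = - (1 / 2) * ?w * affine_moment (?u - 1) (?u / x) k" for k
    have b: "pnorm (?u - 1) \<le> radius x" "pnorm (?u / x) \<le> radius x"
      using pnorm_unit_part_div[OF x0] by (auto simp: radius_def)
    have "pnorm (v k) \<le> pnorm (- (1 / 2) * ?w) * real p * radius x ^ k" for k
      unfolding v_def pnorm_mult[of _ "affine_moment _ _ _"] mult.assoc[of "pnorm _" "real p"]
      by (intro mult_left_mono pnorm_affine_moment_le b) auto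
    then have "power_series_on (ball 1 r) 1 (\<lambda>s. \<Sum>k. (s gchoose k) * v k)"
      using \<rho> null by (intro power_series_on_gbinomial_suminf[where \<rho> = "radius x"]) auto
    then show "power_series_on (ball 1 r - {0}) 1 (\<lambda>s. s * fps_nth (G_star p \<iota> s x) 0)"
    proof (rule power_series_on_cong, intro conjI)
      fix s :: 'a assume s: "s \<in> ball 1 r - {0}"
      then show s1: "s \<in> ball 1 r" by simp
      let ?M = "\<lambda>k. (s gchoose k) * affine_moment (?u - 1) (?u / x) k"
      have z: "?z (of_nat a) = ?u - 1 + ?u / x * of_nat a" for a
        by (rule unit_part_add_minus_one[OF x pnorm_of_nat_le_1])
      have f: "(\<lambda>n. ?w * (s gchoose n) * (?u - 1 + ?u / x * of_nat a) ^ n) sums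
          (omega_v p \<iota> (x + of_nat a) * padic_pow (unit_part p \<iota> (x + of_nat a)) s)" for a
        using sums_mult_pnorm[OF pw[OF s1], of ?w a] by (simp only: w z mult.assoc)
      have f1: "(\<lambda>n. (s gchoose n) * (?u - 1 + ?u / x * of_nat a) ^ n) sums
          (padic_pow (unit_part p \<iota> (x + of_nat a)) s)" for a
        using pw[OF s1, of a] by (simp only: z)
      have "(\<lambda>n. pnorm (s gchoose n) * radius x ^ n) \<longlonglongrightarrow> 0"
        using null[OF s1] by (simp add: binom_null_def)
      from summable_affine_moments[of "\<lambda>n. s gchoose n" "?u - 1" "?u / x"
          "\<lambda>a. padic_pow (unit_part p \<iota> (x + a)) s", OF f1 b this]
      have M: "summable ?M" .
      have "volkenborn p (\<lambda>a. omega_v p \<iota> (x + a) * padic_pow (unit_part p \<iota> (x + a)) s) = ?w * (\<Sum>k. ?M k)"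
        using volkenborn_affine_series[of "\<lambda>n. ?w * (s gchoose n)", OF f b binom_null_pnorm_mult[OF null[OF s1]]]
          sums_mult_pnorm[OF summable_sums[OF M], of ?w]
        by (simp add: sums_iff mult.assoc)
      then have "s * fps_nth (G_star p \<iota> s x) 0 = - (1 / 2) * ?w * (\<Sum>k. ?M k)"
        using s by (simp add: G_star_def G_coeff_zero)
      moreover have "(\<lambda>k. (s gchoose k) * v k) sums (- (1 / 2) * ?w * (\<Sum>k. ?M k))"
        using sums_mult_pnorm[OF summable_sums[OF M], of "- (1 / 2) * ?w"]
        by (simp add: v_def mult_ac)
      ultimately show "(\<Sum>k. (s gchoose k) * v k) = s * fps_nth (G_star p \<iota> s x) 0"
        by (simp add: sums_iff)
    qed
  qed
qed

lemma exists_ball_subset_G_domain: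
  assumes "pnorm x > 1"
  shows "\<exists>r>0. ball 1 r \<subseteq> G_domain p \<iota> x"
  using binom_null_near_one[OF radius_bounds[OF assms]] G_domain_iff[OF assms] by blast

end

section \<open>Finite extensions, uniformizers and ramification\<close>

locale padic_uniformizer = padic_complex p ty
  for p and ty :: "'a::{field_char_0, alg_closed_field, complete_space} itself" +
  fixes K :: "'a set" and \<pi> :: 'a
  assumes finite_ext: "finite_ext K" and uniformizer_in: "\<pi> \<in> K"
    and max_ideal_eq: "max_ideal K = gen_ideal K \<pi>"
begin

lemma diff_in: "y \<in> K \<Longrightarrow> z \<in> K \<Longrightarrow> y - z \<in> K"
  and mult_in: "y \<in> K \<Longrightarrow> z \<in> K \<Longrightarrow> y * z \<in> K"
  and inverse_in: "y \<in> K \<Longrightarrow> inverse y \<in> K"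
  and padic_nums_subset: "padic_nums \<subseteq> K"
proof -
  have "(\<forall>y\<in>K. \<forall>z\<in>K. y - z \<in> K \<and> y * z \<in> K) \<and> (\<forall>y\<in>K. inverse y \<in> K) \<and> padic_nums \<subseteq> K"
    using finite_ext unfolding finite_ext_def by (elim conjE) (intro conjI)
  then show "y \<in> K \<Longrightarrow> z \<in> K \<Longrightarrow> y - z \<in> K" "y \<in> K \<Longrightarrow> z \<in> K \<Longrightarrow> y * z \<in> K"
    "y \<in> K \<Longrightarrow> inverse y \<in> K" "padic_nums \<subseteq> K"
    by blast+
qed

lemma of_nat_in: "(of_nat n :: 'a) \<in> K"
  using padic_nums_subset closure_subset[of "\<rat> :: 'a set"] Rats_of_nat[of n, where 'a = 'a]
  unfolding padic_nums_def by blast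

lemma one_in: "1 \<in> K"
  using of_nat_in[of 1] by simp

lemma divide_in: "y \<in> K \<Longrightarrow> z \<in> K \<Longrightarrow> y / z \<in> K"
  by (simp add: divide_inverse mult_in inverse_in)

lemma power_in: "y \<in> K \<Longrightarrow> y ^ n \<in> K"
  by (induction n) (auto simp: one_in mult_in)

lemma powi_in: "y \<in> K \<Longrightarrow> y powi i \<in> K"
  by (simp add: power_int_def power_in inverse_in)

lemma gen_ideal_pnorm_le: "z \<in> gen_ideal K y \<Longrightarrow> pnorm z \<le> pnorm y"
  using mult_left_mono[OF _ pnorm_nonneg, of _ 1 y]
  by (auto simp: gen_ideal_def int_ring_def pnorm_mult)

lemma generator_in_gen_ideal: "y \<in> gen_ideal K y"
  unfolding gen_ideal_def int_ring_def using one_in by (intro image_eqI[of _ _ 1]) auto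

lemma pnorm_le_uniformizer: "y \<in> K \<Longrightarrow> pnorm y < 1 \<Longrightarrow> pnorm y \<le> pnorm \<pi>"
  using max_ideal_eq gen_ideal_pnorm_le[of y \<pi>] by (auto simp: max_ideal_def)

lemma pnorm_uniformizer: "0 < pnorm \<pi>" "pnorm \<pi> < 1"
proof -
  have "pnorm (of_nat p :: 'a) < 1" "pnorm (of_nat p :: 'a) > 0"
    using p_gt_1 by (simp_all add: pnorm_p)
  then show "0 < pnorm \<pi>"
    using pnorm_le_uniformizer[OF of_nat_in, of p] by linarith
  show "pnorm \<pi> < 1"
    using generator_in_gen_ideal[of \<pi>] max_ideal_eq by (auto simp: max_ideal_def)
qed

text \<open>A nonunit is divisible by \<pi>, and dividing enlarges the norm by a fixed factor; since
  norms stay at most 1, this ends at a unit.\<close>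

lemma pnorm_eq_power_uniformizer:
  assumes "y \<in> K" "y \<noteq> 0" "pnorm y \<le> 1"
  obtains k where "pnorm y = pnorm \<pi> ^ k"
proof -
  have "\<exists>k. pnorm y = pnorm \<pi> ^ k" if "y \<in> K" "pnorm \<pi> ^ n < pnorm y" "pnorm y \<le> 1" for n y
    using that
  proof (induction n arbitrary: y)
    case (Suc n)
    show ?case
    proof (cases "pnorm y = 1")
      case False
      then have "y \<in> max_ideal K" using Suc.prems by (simp add: max_ideal_def)
      then obtain z where z: "z \<in> K" "pnorm z \<le> 1" "y = \<pi> * z"
        unfolding max_ideal_eq by (auto simp: gen_ideal_def int_ring_def)
      then have "pnorm \<pi> ^ n < pnorm z"
        using Suc.prems(2) pnorm_uniformizer by (simp add: pnorm_mult)
      then obtain k where "pnorm z = pnorm \<pi> ^ k" using Suc.IH z by blast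
      then have "pnorm y = pnorm \<pi> ^ Suc k" by (simp add: z(3) pnorm_mult)
      then show ?thesis by blast
    qed (auto intro: exI[of _ 0])
  qed auto
  moreover obtain n where "pnorm \<pi> ^ n < pnorm y"
    using real_arch_pow_inv[of "pnorm y" "pnorm \<pi>"] assms pnorm_uniformizer by auto
  ultimately show ?thesis using assms that by blast
qed

lemma gen_ideal_subset:
  assumes "y \<in> K" "z \<in> K" "z \<noteq> 0" "pnorm y \<le> pnorm z"
  shows "gen_ideal K y \<subseteq> gen_ideal K z"
proof
  fix t assume "t \<in> gen_ideal K y"
  then obtain w where w: "w \<in> K" "pnorm w \<le> 1" "t = y * w"
    by (auto simp: gen_ideal_def int_ring_def)
  have "pnorm (y / z) \<le> 1" using assms by (simp add: pnorm_divide)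
  then have "pnorm (y / z * w) \<le> 1"
    unfolding pnorm_mult using w mult_mono[of "pnorm (y / z)" 1 "pnorm w" 1] by simp
  moreover have "y / z * w \<in> K" by (intro mult_in divide_in assms w)
  ultimately have "y / z * w \<in> int_ring K" unfolding int_ring_def by blast
  then show "t \<in> gen_ideal K z"
    using assms unfolding gen_ideal_def by (intro image_eqI[of _ _ "y / z * w"]) (auto simp: w)
qed

text \<open>An ideal determines the norm of its generator. Hence any two generators of the maximal
  ideal have equal norm, strictly between 0 and 1, and the exponent in the definite description is
  unique.\<close>

lemma pnorm_uniformizer_ram_index: "pnorm \<pi> ^ ram_index p K = 1 / real p"
proof -
  have p1: "pnorm (of_nat p :: 'a) < 1" using p_gt_1 by (simp add: pnorm_p)
  obtain e where e: "pnorm (of_nat p :: 'a) = pnorm \<pi> ^ e"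
    using pnorm_eq_power_uniformizer[OF of_nat_in, of p] p1 p_gt_1 by auto
  have \<pi>0: "\<pi> \<noteq> 0" using pnorm_uniformizer by auto
  have "gen_ideal K (of_nat p) = gen_ideal K (\<pi> ^ e)"
    using e \<pi>0 p_gt_1
    by (intro subset_antisym gen_ideal_subset of_nat_in power_in uniformizer_in) (auto simp: pnorm_power)
  moreover have "n = e"
    if n: "\<exists>\<pi>'\<in>K. max_ideal K = gen_ideal K \<pi>' \<and> gen_ideal K (of_nat p) = gen_ideal K (\<pi>' ^ n)" for n
  proof -
    obtain \<pi>' where \<pi>': "\<pi>' \<in> K" "max_ideal K = gen_ideal K \<pi>'"
      "gen_ideal K (of_nat p) = gen_ideal K (\<pi>' ^ n)"
      using n by blast
    have "pnorm \<pi>' = pnorm \<pi>"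
      using gen_ideal_pnorm_le[of \<pi> \<pi>'] gen_ideal_pnorm_le[of \<pi>' \<pi>] max_ideal_eq \<pi>'(2)
        generator_in_gen_ideal by (metis order.antisym)
    moreover have "pnorm (of_nat p :: 'a) = pnorm (\<pi>' ^ n)"
      using gen_ideal_pnorm_le \<pi>'(3) generator_in_gen_ideal by (metis order.antisym)
    ultimately have "pnorm \<pi> ^ n = pnorm \<pi> ^ e" using e by (simp add: pnorm_power)
    then show "n = e"
      using pnorm_uniformizer power_strict_decreasing[of n e "pnorm \<pi>"]
        power_strict_decreasing[of e n "pnorm \<pi>"]
      by (cases n e rule: linorder_cases) auto
  qed
  ultimately have "ram_index p K = e"
    unfolding ram_index_def using max_ideal_eq uniformizer_in by (intro the_equality) blast+
  then show ?thesis using e by (simp add: pnorm_p)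
qed

text \<open>With e the ramification index, \<pi> has norm p^(-1/e), and e < p - 1 makes the exponent
  smaller than -1/(p - 1).\<close>

lemma pnorm_uniformizer_less:
  assumes "ram_index p K < p - 1"
  shows "pnorm \<pi> < real p powr (- 1 / (real p - 1))"
proof -
  let ?e = "ram_index p K"
  have e: "?e > 0" using pnorm_uniformizer_ram_index p_gt_1 by (intro Nat.gr0I) auto
  have "real p powr (- 1) < real p powr (- 1 / (real p - 1) * real ?e)"
    using assms p_gt_1 by (intro powr_less_mono) (auto simp: field_simps)
  then have "pnorm \<pi> ^ ?e < (real p powr (- 1 / (real p - 1))) ^ ?e"
    using p_gt_1 unfolding pnorm_uniformizer_ram_index
    by (simp only: powr_power) (simp add: powr_minus_divide)
  then show ?thesis by (rule power_less_imp_less_base) simp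
qed

end

context padic_complex_embedding
begin

text \<open>The unit part of \<open>x\<close> need not lie in \<open>K\<close>, but its power with exponent the ramification
  index times the order of \<open>teich p \<iota> x\<close> does. This exponent is prime to \<open>p\<close>, so that the
  power has the same distance to 1.\<close>

lemma radius_le_uniformizer:
  assumes K: "padic_uniformizer p K \<pi>" and x: "x \<in> K" "pnorm x > 1"
    and ram: "ram_index p K < p - 1"
  shows "radius x \<le> pnorm \<pi>"
proof -
  interpret padic_uniformizer p ty K \<pi> using K by (simp add: padic_uniformizer_def padic_uniformizer_axioms_def padic_complex_axioms)
  let ?e = "ram_index p K"
  let ?u = "unit_part p \<iota> x"
  have x0: "x \<noteq> 0" using x nonzero_of_pnorm_gt_1 by blast
  have e: "?e > 0" using pnorm_uniformizer_ram_index p_gt_1 by (intro Nat.gr0I) auto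
  have ix: "pnorm (1 / x) < 1" using x x0 by (simp add: pnorm_divide divide_less_eq_1)
  have "1 / x \<in> K" using x by (simp add: divide_in one_in)
  from pnorm_le_uniformizer[OF this ix] have bx: "1 / pnorm x \<le> pnorm \<pi>" by (simp add: pnorm_divide)
  obtain k where k: "pnorm (1 / x) = pnorm \<pi> ^ k"
    using pnorm_eq_power_uniformizer[OF \<open>1 / x \<in> K\<close>] ix x0 by auto
  \<comment> \<open>The e-th power of the norm of x is an integral power of p, so the e-th power of
    \<open>ppow p \<iota> (vp p x)\<close> is a power of p itself and lies in K.\<close>
  have "pnorm (1 / x) ^ ?e = (pnorm \<pi> ^ ?e) ^ k"
    by (simp add: k mult.commute flip: power_mult)
  then have "pnorm x ^ ?e = real p powi int k"
    by (simp add: pnorm_uniformizer_ram_index pnorm_divide power_one_over)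
  from ppow_power[OF x0 e this] have P: "ppow p \<iota> (vp p x) ^ ?e \<in> K"
    by (simp add: powi_in of_nat_in)
  obtain m where m: "m > 0" "coprime m p" "teich p \<iota> x ^ m = 1"
    using teich_root_of_unity[OF x0] by blast
  have "?u ^ (?e * m) = x ^ (?e * m) / (ppow p \<iota> (vp p x) ^ ?e) ^ m / (teich p \<iota> x ^ m) ^ ?e"
    by (simp add: unit_part_def power_divide power_mult_distrib mult.commute flip: power_mult)
  then have "?u ^ (?e * m) \<in> K"
    using m(3) P x(1) by (simp add: divide_in power_in)
  then have uK: "?u ^ (?e * m) - 1 \<in> K" by (simp add: diff_in one_in)
  \<comment> \<open>A positive index below \<open>p - 1\<close> cannot be divisible by p.\<close>
  have "\<not> p dvd ?e" using ram e by (auto dest: dvd_imp_le)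
  moreover have "\<not> p dvd m"
    using m(2) p_gt_1 by (metis coprime_common_divisor dvd_refl less_irrefl nat_dvd_1_iff_1)
  ultimately have "\<not> p dvd ?e * m" using prime_p by (simp add: prime_dvd_mult_iff)
  from pnorm_power_minus_one[OF pnorm_unit_part_minus_one[OF x0] this]
  have "pnorm (?u - 1) \<le> pnorm \<pi>"
    using pnorm_le_uniformizer[OF uK] pnorm_unit_part_minus_one[OF x0] by simp
  then show ?thesis using bx by (simp add: radius_def)
qed

lemma ball_subset_G_domain_of_ramified:
  assumes K: "padic_uniformizer p K \<pi>" and x: "x \<in> K" "pnorm x > 1"
    and ram: "ram_index p K < p - 1"
  shows "ball 1 (inverse (pnorm \<pi>) * real p powr (- 1 / (real p - 1))) \<subseteq> G_domain p \<iota> x"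
proof
  interpret padic_uniformizer p ty K \<pi> using K by (simp add: padic_uniformizer_def padic_uniformizer_axioms_def padic_complex_axioms)
  let ?c = "real p powr (- 1 / (real p - 1))"
  let ?R = "inverse (pnorm \<pi>) * ?c"
  fix s :: 'a assume "s \<in> ball 1 ?R"
  then have s: "pnorm (s - 1) < ?R" by (simp add: dist_eq_pnorm pnorm_minus_commute)
  \<comment> \<open>Bounds the norm of \<open>s - k\<close> for every k, as \<open>1 - k\<close> has
    norm at most 1. The maximum stays below \<open>?R\<close> because the ramification bound gives
    \<open>1 < ?R\<close>.\<close>
  define \<sigma> where "\<sigma> = max (pnorm (s - 1)) 1"
  have "1 < ?R"
    using pnorm_uniformizer_less[OF ram] pnorm_uniformizer by (simp add: field_simps)
  with s have "\<sigma> < ?R" by (simp add: \<sigma>_def)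
  have "\<sigma> * radius x \<le> \<sigma> * pnorm \<pi>"
    using radius_le_uniformizer[OF K x ram] by (intro mult_left_mono) (auto simp: \<sigma>_def)
  also have "\<dots> < ?R * pnorm \<pi>"
    using \<open>\<sigma> < ?R\<close> pnorm_uniformizer by (intro mult_strict_right_mono) auto
  also have "\<dots> = ?c" using pnorm_uniformizer by simp
  finally have "\<sigma> * radius x < ?c" .
  moreover have "pnorm (s - of_nat k) \<le> \<sigma>" for k
    using pnorm_ultrametric[of "s - 1" "1 - of_nat k"] pnorm_of_int_le_1[of "1 - int k"]
    by (simp add: \<sigma>_def)
  ultimately have "binom_null s (radius x)"
    using radius_bounds[OF x(2)] by (intro binom_null_of_bound) auto
  then show "s \<in> G_domain p \<iota> x" using G_domain_iff[OF x(2)] by simp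
qed

end

theorem theorem4p4:
  fixes p :: nat
    and \<iota> :: "complex \<Rightarrow> 'a::{field_char_0, alg_closed_field, complete_space}"
    and x :: 'a
  assumes "padic_complex TYPE('a) p" and "Qbar_embedding \<iota>"
    and "odd p" and "pnorm x > 1"
  shows "(\<exists>r>0. ball 1 r \<subseteq> G_domain p \<iota> x) \<and>
    (\<forall>r. ball 1 r \<subseteq> G_domain p \<iota> x \<longrightarrow> G_star_analytic p \<iota> x r) \<and>
    (\<forall>s\<in>G_domain p \<iota> x.
       pnorm (s - 1) * pnorm (plog (unit_part p \<iota> x)) < real p powr (- 1 / (real p - 1)) \<longrightarrow>
       G_star_expansion p \<iota> s x) \<and>
    (\<forall>K \<pi>. finite_ext K \<and> x \<in> K \<and> ram_index p K < p - 1 \<and>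
       \<pi> \<in> K \<and> max_ideal K = gen_ideal K \<pi> \<longrightarrow>
       (let R = inverse (pnorm \<pi>) * real p powr (- 1 / (real p - 1)) in
         ball 1 R \<subseteq> G_domain p \<iota> x \<and> G_star_analytic p \<iota> x R \<and>
         (\<forall>s. s \<noteq> 0 \<and> pnorm (s - 1) < R \<longrightarrow> G_star_expansion p \<iota> s x)))"
proof -
  interpret padic_complex_embedding p "TYPE('a)" \<iota>
    using assms by (simp add: padic_complex_embedding_def)
  note x = assms(4)
  have "ball 1 R \<subseteq> G_domain p \<iota> x \<and> G_star_analytic p \<iota> x R \<and>
      (\<forall>s. s \<noteq> 0 \<and> pnorm (s - 1) < R \<longrightarrow> G_star_expansion p \<iota> s x)"
    if K: "finite_ext K" "x \<in> K" "ram_index p K < p - 1" "\<pi> \<in> K" "max_ideal K = gen_ideal K \<pi>"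
      and R: "R = inverse (pnorm \<pi>) * real p powr (- 1 / (real p - 1))" for K \<pi> R
  proof -
    have "padic_uniformizer p K \<pi>"
      using K assms(1) by (simp add: padic_uniformizer_def padic_uniformizer_axioms_def)
    then have sub: "ball 1 R \<subseteq> G_domain p \<iota> x"
      unfolding R using K x by (intro ball_subset_G_domain_of_ramified) auto
    moreover have "s \<in> ball 1 R" if "pnorm (s - 1) < R" for s :: 'a
      using that by (simp add: dist_eq_pnorm pnorm_minus_commute)
    ultimately show ?thesis
      using G_star_analytic[OF x sub] G_star_expansion[OF x] by blast
  qed
  note ramified = this
  show ?thesis
  proof (intro conjI allI impI ballI)
    show "\<exists>r>0. ball 1 r \<subseteq> G_domain p \<iota> x"
      by (rule exists_ball_subset_G_domain[OF x])
    show "G_star_analytic p \<iota> x r" if "ball 1 r \<subseteq> G_domain p \<iota> x" for r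
      by (rule G_star_analytic[OF x that])
    show "G_star_expansion p \<iota> s x" if "s \<in> G_domain p \<iota> x" for s
      by (rule G_star_expansion[OF x that])
    fix K \<pi>
    assume "finite_ext K \<and> x \<in> K \<and> ram_index p K < p - 1 \<and> \<pi> \<in> K \<and> max_ideal K = gen_ideal K \<pi>"
    then show "let R = inverse (pnorm \<pi>) * real p powr (- 1 / (real p - 1)) in
        ball 1 R \<subseteq> G_domain p \<iota> x \<and> G_star_analytic p \<iota> x R \<and>
        (\<forall>s. s \<noteq> 0 \<and> pnorm (s - 1) < R \<longrightarrow> G_star_expansion p \<iota> s x)"
      unfolding Let_def by (elim conjE) (rule ramified[OF _ _ _ _ _ refl])
  qed
qed

end
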